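(* Let $f:[0,1]\to[0,1]$ be defined by $f(\alpha)=\min(3\alpha/2,(1+\alpha)/2)$ and let $\mathcal{U}=\{(\alpha_1,\alpha_2)\in[0,1]^2 : \alpha_2\geq f(\alpha_1)\}$. Then: (1) $\{(\overline{d}(A),\overline{d}(2A)) : A\subset\mathbb{N}\} = \{\tfrac{1}{k}(\alpha_1,\alpha_2) : (\alpha_1,\alpha_2)\in\mathcal{U},\ k\in\mathbb{N},\ k\geq 1\}$; (2) $\{(\overline{d}(A),\underline{d}(2A)) : A\subset\mathbb{N}\} = [0,1]^2$.
   Context: For $A\subset\mathbb{N}$, $2A=A+A=\{a+b:(a,b)\in A^2\}$. The lower and upper asymptotic densities are $\underline{d}(A)=\liminf_{N\to\infty}\frac{|A\cap\{1,\dots,N\}|}{N}$ and $\overline{d}(A)=\limsup_{N\to\infty}\frac{|A\cap\{1,\dots,N\}|}{N}$. *)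

theory Defs
  imports Complex_Main "HOL-Library.Extended_Real" "HOL-Library.Liminf_Limsup" "HOL-Library.Set_Algebras"
begin

text \<open>
  The densities are real numbers; the limits are taken in the complete lattice \<^typ>\<open>ereal\<close>
  and converted back, which loses nothing because the quotients lie in the unit interval
  (see the two lemmas below). The junk value at \<open>N = 0\<close> does not affect the limits.
\<close>

definition lower_density :: "nat set \<Rightarrow> real" where
  "lower_density A =
     real_of_ereal (liminf (\<lambda>N. ereal (real (card (A \<inter> {1..N})) / real N)))"

definition upper_density :: "nat set \<Rightarrow> real" where
  "upper_density A =
     real_of_ereal (limsup (\<lambda>N. ereal (real (card (A \<inter> {1..N})) / real N)))"

lemma density_quotient_bounds:
  "0 \<le> real (card (A \<inter> {1..N})) / real N" "real (card (A \<inter> {1..N})) / real N \<le> 1"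
proof -
  have "card (A \<inter> {1..N}) \<le> card {1..N}"
    by (intro card_mono) auto
  then have "card (A \<inter> {1..N}) \<le> N" by simp
  then show "real (card (A \<inter> {1..N})) / real N \<le> 1"
    by (simp add: divide_le_eq)
qed simp

lemma ereal_lower_density:
  "ereal (lower_density A) = liminf (\<lambda>N. ereal (real (card (A \<inter> {1..N})) / real N))"
proof -
  let ?q = "\<lambda>N. ereal (real (card (A \<inter> {1..N})) / real N)"
  have "0 \<le> liminf ?q"
    by (intro Liminf_bounded always_eventually allI)
       (use density_quotient_bounds(1) in simp)
  moreover have "limsup ?q \<le> 1"
    by (intro Limsup_bounded always_eventually allI)
       (use density_quotient_bounds(2) in \<open>simp add: one_ereal_def\<close>)
  moreover have "liminf ?q \<le> limsup ?q"
    by (intro Liminf_le_Limsup) simp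
  ultimately have "\<bar>liminf ?q\<bar> \<noteq> \<infinity>" by auto
  then show ?thesis
    unfolding lower_density_def by (rule ereal_real')
qed

lemma ereal_upper_density:
  "ereal (upper_density A) = limsup (\<lambda>N. ereal (real (card (A \<inter> {1..N})) / real N))"
proof -
  let ?q = "\<lambda>N. ereal (real (card (A \<inter> {1..N})) / real N)"
  have "0 \<le> liminf ?q"
    by (intro Liminf_bounded always_eventually allI)
       (use density_quotient_bounds(1) in simp)
  moreover have "limsup ?q \<le> 1"
    by (intro Limsup_bounded always_eventually allI)
       (use density_quotient_bounds(2) in \<open>simp add: one_ereal_def\<close>)
  moreover have "liminf ?q \<le> limsup ?q"
    by (intro Liminf_le_Limsup) simp
  ultimately have "\<bar>limsup ?q\<bar> \<noteq> \<infinity>" by auto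
  then show ?thesis
    unfolding upper_density_def by (rule ereal_real')
qed

definition density_f :: "real \<Rightarrow> real" where
  "density_f \<alpha> = min (3 * \<alpha> / 2) ((1 + \<alpha>) / 2)"

definition region_U :: "(real \<times> real) set" where
  "region_U = {(\<alpha>1, \<alpha>2). \<alpha>1 \<in> {0..1} \<and> \<alpha>2 \<in> {0..1} \<and> \<alpha>2 \<ge> density_f \<alpha>1}"

end

theory Submission
  imports Defs
begin

text \<open>
  After an affine change of variable \<open>A\<close> contains 0 and has greatest common divisor 1; the divisor
  taken out is the \<open>k\<close> of the statement. Freiman's theorem
  \<open>card (A + A) \<ge> min (3 * card A - 3) (card A + Max A)\<close>, applied to initial segments of \<open>A\<close> that
  nearly attain the upper density and end in an element of \<open>A\<close>, then gives the bound
  \<open>\<alpha>2 \<ge> density_f \<alpha>1\<close>.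

  Conversely, sets are built in stages at rapidly increasing scales, so that earlier stages are
  negligible. An interval \<open>((1 - \<alpha>) M, M]\<close> gives \<open>A\<close> density \<open>\<alpha>\<close> at \<open>M\<close> and \<open>A + A\<close> at most
  \<open>density_f \<alpha>\<close> nearby. A set of about \<open>2 q\<close> elements whose sumset contains an interval of
  length \<open>q\<^sup>2\<close> raises the density of \<open>A + A\<close> to any larger value without affecting that of \<open>A\<close>.
  For the lower density, an arithmetic progression of difference \<open>q\<close> plus an earlier run of \<open>q\<close>
  consecutive elements covers an interval \<open>[N, w]\<close>; leaving out everything between \<open>w\<close> and the
  next \<open>N = w / \<beta>\<close> makes the lower density equal to \<open>\<beta>\<close>.
\<close>

section \<open>Freiman's theorem\<close>

text \<open>\<open>density_f\<close> is Freiman's inequality divided by \<open>2 * a\<close>: a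
  segment ending in \<open>a\<close> with about \<alpha> * a elements has its sumset in [0, 2a], and
  the two terms 3 \<alpha> a and \<alpha> a + a become 3 \<alpha> / 2 and (1 + \<alpha>) / 2. The
  hard range of Freiman's theorem is \<open>a + 3 > 2 * card A\<close>, too sparse for pigeonhole on
  the whole interval. Two consecutive elements at a suitable height of a walk allow a cut and
  induction on the cardinality; a set without such a pair is so rigid that its sums can be counted
  directly, or its largest element can be removed. In the constructions the difficulty is
  interference between stages. Old small elements plus a new interval nearly reproduce that
  interval, which is why it costs three times its length and not twice. An interval stage only
  bounds the sumset from above, so even for \<beta> = \<open>density_f\<close> \<alpha> the value
  \<beta> is attained by the thin stages. For the lower density, A + A must be nearly full up to w
  and nearly empty just beyond, although sums reach 2w; this works because the sumset of an
  arithmetic progression has only about twice as many elements.\<close>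

text \<open>The part of \<open>A\<close> in \<open>{l..h}\<close> and its reflection under
  \<open>l + h - x\<close> have together more elements than the interval, so they meet.\<close>

lemma add_mem_sumset_if_dense:
  fixes A :: "nat set"
  assumes "l \<le> h" "h + 1 < 2 * card (A \<inter> {l..h}) + l"
  shows "l + h \<in> A + A"
proof -
  define S where "S = A \<inter> {l..h}"
  define S' where "S' = (\<lambda>x. l + h - x) ` S"
  have inj: "inj_on (\<lambda>x. l + h - x) S"
    by (rule inj_onI) (auto simp: S_def)
  have "card S' = card S" using inj by (simp add: S'_def card_image)
  have "S \<inter> S' \<noteq> {}"
  proof
    assume "S \<inter> S' = {}"
    then have "card (S \<union> S') = card S + card S'"
      by (intro card_Un_disjoint) (auto simp: S_def S'_def)
    moreover have "card (S \<union> S') \<le> card {l..h}"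
      by (intro card_mono) (auto simp: S_def S'_def)
    ultimately show False
      using assms \<open>card S' = card S\<close> by (simp add: S_def)
  qed
  then obtain x y where "x \<in> S" "y \<in> S" "x = l + h - y" by (auto simp: S'_def)
  then have "l + h = x + y" "x \<in> A" "y \<in> A" by (auto simp: S_def)
  then show ?thesis by (metis set_plus_intro)
qed

text \<open>Count modulo \<open>a\<close>. If \<open>n\<close> and \<open>n + a\<close> both failed
  to be sums, pigeonhole on \<open>{0..n}\<close> and \<open>{n..a}\<close> would give
  \<open>2 * card A \<le> a + 2\<close>. So every residue is hit, those of \<open>A - {a}\<close>
  are hit twice (add 0 and add \<open>a\<close>), and \<open>2 * a\<close> is one more.\<close>

lemma card_sumset_dense:
  fixes A :: "nat set"
  assumes fin: "finite A" and "0 \<in> A" "a \<in> A" "A \<subseteq> {..a}" and dense: "a + 3 \<le> 2 * card A"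
  shows "card A + a \<le> card (A + A)"
proof -
  define U where "U = {n. n < a \<and> n \<in> A + A}"
  define V where "V = {n. n < a \<and> n + a \<in> A + A}"
  have finUV: "finite U" "finite V" by (auto simp: U_def V_def)
  have "n \<in> U \<union> V" if n: "n < a" for n
  proof (rule ccontr)
    assume "n \<notin> U \<union> V"
    then have "n \<notin> A + A" "n + a \<notin> A + A" using n by (auto simp: U_def V_def)
    then have "\<not> n + 1 < 2 * card (A \<inter> {0..n}) + 0" "\<not> a + 1 < 2 * card (A \<inter> {n..a}) + n"
      using add_mem_sumset_if_dense[of 0 n A] add_mem_sumset_if_dense[of n a A] n by auto
    moreover have "card A \<le> card (A \<inter> {0..n}) + card (A \<inter> {n..a})"
    proof -
      have "A = (A \<inter> {0..n}) \<union> (A \<inter> {n..a})" using assms(4) by auto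
      then show ?thesis by (metis card_Un_le)
    qed
    ultimately show False using dense by linarith
  qed
  then have un: "U \<union> V = {..<a}" by (auto simp: U_def V_def)
  have "A - {a} \<subseteq> U \<inter> V"
  proof
    fix x assume x: "x \<in> A - {a}"
    then have "x < a" using assms(4) by force
    moreover have "0 + x \<in> A + A" "x + a \<in> A + A"
      using x assms by (blast intro: set_plus_intro)+
    ultimately show "x \<in> U \<inter> V" by (simp add: U_def V_def)
  qed
  then have "card (A - {a}) \<le> card (U \<inter> V)" using finUV by (intro card_mono) auto
  then have 1: "card A - 1 \<le> card (U \<inter> V)" using assms by simp
  have 2: "card U + card V = a + card (U \<inter> V)"
    using card_Un_Int[OF finUV] un by simp
  have "U \<union> (\<lambda>n. n + a) ` V \<union> {2 * a} \<subseteq> A + A"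
    using set_plus_intro[OF \<open>a \<in> A\<close> \<open>a \<in> A\<close>] by (auto simp: U_def V_def mult_2)
  then have "card (U \<union> (\<lambda>n. n + a) ` V \<union> {2 * a}) \<le> card (A + A)"
    using fin by (intro card_mono finite_set_plus)
  moreover have "card (U \<union> (\<lambda>n. n + a) ` V \<union> {2 * a}) = card U + card V + 1"
  proof -
    have "card (U \<union> (\<lambda>n. n + a) ` V \<union> {2 * a}) = card (U \<union> (\<lambda>n. n + a) ` V) + card {2 * a}"
      using finUV \<open>a \<in> A\<close> by (intro card_Un_disjoint) (auto simp: U_def V_def)
    also have "card (U \<union> (\<lambda>n. n + a) ` V) = card U + card ((\<lambda>n. n + a) ` V)"
      using finUV by (intro card_Un_disjoint) (auto simp: U_def V_def)
    also have "card ((\<lambda>n. n + a) ` V) = card V" by (intro card_image) auto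
    finally show ?thesis by simp
  qed
  moreover have "card A \<ge> 1" using assms by (metis card_0_eq empty_iff less_one not_less)
  ultimately show ?thesis using 1 2 by linarith
qed

text \<open>The translates \<open>Min A + A\<close> and \<open>Max A + (A - {Min A})\<close> are
  disjoint: \<open>Min A + Max A\<close> bounds the first from above, and the second lies strictly
  beyond it.\<close>

lemma card_sumset_ge:
  fixes A :: "nat set"
  assumes fin: "finite A" and "A \<noteq> {}"
  shows "2 * card A \<le> card (A + A) + 1"
proof -
  define l where "l = Min A"
  define h where "h = Max A"
  have lh: "l \<in> A" "h \<in> A" "\<And>x. x \<in> A \<Longrightarrow> l \<le> x \<and> x \<le> h"
    using assms by (auto simp: l_def h_def)
  have "card ((\<lambda>x. l + x) ` A \<union> (\<lambda>x. h + x) ` (A - {l})) = card A + card (A - {l})"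
  proof (subst card_Un_disjoint)
    have "l + x \<noteq> h + y" if "x \<in> A" "y \<in> A - {l}" for x y
      using lh(3)[of x] lh(3)[of y] that by auto
    then show "(\<lambda>x. l + x) ` A \<inter> (\<lambda>x. h + x) ` (A - {l}) = {}" by blast
  qed (use fin in \<open>auto simp: card_image\<close>)
  moreover have "(\<lambda>x. l + x) ` A \<union> (\<lambda>x. h + x) ` (A - {l}) \<subseteq> A + A"
    using lh by (auto intro: set_plus_intro)
  then have "card ((\<lambda>x. l + x) ` A \<union> (\<lambda>x. h + x) ` (A - {l})) \<le> card (A + A)"
    using fin by (intro card_mono finite_set_plus)
  ultimately show ?thesis using lh fin by simp
qed

lemma sumset_affine_image:
  fixes B :: "nat set"
  shows "(\<lambda>b. c + g * b) ` B + (\<lambda>b. c + g * b) ` B = (\<lambda>b. 2 * c + g * b) ` (B + B)"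
proof (intro equalityI subsetI)
  fix n assume "n \<in> (\<lambda>b. c + g * b) ` B + (\<lambda>b. c + g * b) ` B"
  then obtain x y where "x \<in> B" "y \<in> B" "n = (c + g * x) + (c + g * y)" by (auto elim!: set_plus_elim)
  then have "n = 2 * c + g * (x + y)" "x + y \<in> B + B" by (auto simp: algebra_simps intro: set_plus_intro)
  then show "n \<in> (\<lambda>b. 2 * c + g * b) ` (B + B)" by blast
next
  fix n assume "n \<in> (\<lambda>b. 2 * c + g * b) ` (B + B)"
  then obtain x y where "x \<in> B" "y \<in> B" "n = 2 * c + g * (x + y)" by (auto elim!: set_plus_elim)
  then have "n = (c + g * x) + (c + g * y)" "x \<in> B" "y \<in> B" by (auto simp: algebra_simps)
  then show "n \<in> (\<lambda>b. c + g * b) ` B + (\<lambda>b. c + g * b) ` B" by (metis imageI set_plus_intro)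
qed

lemma card_sumset_reflect:
  fixes A :: "nat set"
  assumes "A \<subseteq> {..a}"
  shows "card ((\<lambda>x. a - x) ` A + (\<lambda>x. a - x) ` A) = card (A + A)"
proof -
  have "(\<lambda>x. a - x) ` A + (\<lambda>x. a - x) ` A = (\<lambda>s. 2 * a - s) ` (A + A)"
  proof (intro equalityI subsetI)
    fix n assume "n \<in> (\<lambda>x. a - x) ` A + (\<lambda>x. a - x) ` A"
    then obtain x y where xy: "x \<in> A" "y \<in> A" "n = (a - x) + (a - y)" by (auto elim!: set_plus_elim)
    moreover have "x \<le> a" "y \<le> a" using xy assms by auto
    ultimately have "n = 2 * a - (x + y)" "x + y \<in> A + A" by (auto intro: set_plus_intro)
    then show "n \<in> (\<lambda>s. 2 * a - s) ` (A + A)" by blast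
  next
    fix n assume "n \<in> (\<lambda>s. 2 * a - s) ` (A + A)"
    then obtain x y where xy: "x \<in> A" "y \<in> A" "n = 2 * a - (x + y)" by (auto elim!: set_plus_elim)
    moreover have "x \<le> a" "y \<le> a" using xy assms by auto
    ultimately have "n = (a - x) + (a - y)" by auto
    with xy show "n \<in> (\<lambda>x. a - x) ` A + (\<lambda>x. a - x) ` A" by (metis imageI set_plus_intro)
  qed
  moreover have "inj_on (\<lambda>s. 2 * a - s) (A + A)"
  proof (rule inj_onI)
    fix s t assume st: "s \<in> A + A" "t \<in> A + A" "2 * a - s = 2 * a - t"
    have "u \<le> 2 * a" if "u \<in> A + A" for u
    proof -
      obtain x y where "x \<in> A" "y \<in> A" "u = x + y" using \<open>u \<in> A + A\<close> by (elim set_plus_elim)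
      moreover have "x \<le> a" "y \<le> a" using calculation assms by auto
      ultimately show ?thesis by simp
    qed
    then have "s \<le> 2 * a" "t \<le> 2 * a" using st by auto
    then show "s = t" using st by linarith
  qed
  ultimately show ?thesis by (simp add: card_image)
qed

text \<open>\<open>excess A\<close> is a walk with steps \<open>\<plusminus>1\<close>; where it is at most \<open>- 2\<close>, the set \<open>A\<close> fills more than
  half of the initial interval, so that the pigeonhole principle applies.\<close>

definition excess :: "nat set \<Rightarrow> nat \<Rightarrow> int" where
  "excess A n = int n - 2 * int (card (A \<inter> {..n}))"

lemma excess_0: "0 \<in> A \<Longrightarrow> excess A 0 = - 2"
proof -
  assume "0 \<in> A"
  then have "A \<inter> {..0} = {0}" by auto
  then show ?thesis by (simp add: excess_def)
qed

lemma card_Int_atMost_Suc: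
  "card (A \<inter> {..Suc n}) = card (A \<inter> {..n}) + (if Suc n \<in> A then 1 else 0)"
proof (cases "Suc n \<in> A")
  case True
  then have "A \<inter> {..Suc n} = insert (Suc n) (A \<inter> {..n})" by auto
  then show ?thesis using True by simp
next
  case False
  then have "A \<inter> {..Suc n} = A \<inter> {..n}" by (auto simp: le_Suc_eq)
  then show ?thesis using False by simp
qed

lemma excess_Suc: "excess A (Suc n) = excess A n + (if Suc n \<in> A then - 1 else 1)"
  by (simp add: excess_def card_Int_atMost_Suc)

lemma mem_sumset_if_excess: "excess A n \<le> - 2 \<Longrightarrow> n \<in> A + A"
  using add_mem_sumset_if_dense[of 0 n A] by (simp add: excess_def atLeast0AtMost)

lemma card_Int_atMost_diff:
  fixes A :: "nat set"
  assumes "finite A" "m \<le> n"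
  shows "card (A \<inter> {m<..n}) + card (A \<inter> {..m}) = card (A \<inter> {..n})"
proof -
  have "A \<inter> {..n} = (A \<inter> {m<..n}) \<union> (A \<inter> {..m})" using assms by auto
  moreover have "card ((A \<inter> {m<..n}) \<union> (A \<inter> {..m})) = card (A \<inter> {m<..n}) + card (A \<inter> {..m})"
    using assms by (intro card_Un_disjoint) auto
  ultimately show ?thesis by simp
qed

text \<open>Cut \<open>A\<close> into the part up to \<open>x + 1\<close> and the part from \<open>x\<close> on. The two sumsets share at most
  \<open>2x, 2x + 1, 2x + 2\<close>, and two consecutive elements keep both greatest common divisors equal to 1.\<close>

lemma card_sumset_split:
  fixes A :: "nat set"
  assumes fin: "finite A" and "0 \<in> A" "a \<in> A" "A \<subseteq> {..a}"
    and x: "x \<in> A" "Suc x \<in> A" "0 < x" "Suc x < a"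
    and ex: "- 2 \<le> excess A x" "excess A (Suc x) \<le> excess A a"
    and IH: "\<And>B. finite B \<Longrightarrow> card B < card A \<Longrightarrow> 0 \<in> B \<Longrightarrow> Gcd B = 1 \<Longrightarrow>
               min (3 * card B - 3) (card B + Max B) \<le> card (B + B)"
  shows "3 * card A - 3 \<le> card (A + A)"
proof -
  define k where "k = card A"
  define c where "c = card (A \<inter> {..x})"
  define B where "B = A \<inter> {..Suc x}"
  define C where "C = A \<inter> {x..}"
  define D where "D = {n. x + n \<in> A}"
  have finB: "finite B" "finite C" using fin by (auto simp: B_def C_def)
  have CD: "C = (\<lambda>n. x + n) ` D"
  proof (intro equalityI subsetI)
    fix n assume "n \<in> C"
    then have "n = x + (n - x)" "n - x \<in> D" by (auto simp: C_def D_def)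
    then show "n \<in> (\<lambda>n. x + n) ` D" by blast
  qed (auto simp: C_def D_def)
  have finD: "finite D" using finB CD by (metis finite_imageD inj_on_add)
  have cardD: "card D = card C" using CD by (metis card_image inj_on_add)
  have cB: "card B = c + 1" using x by (simp add: B_def c_def card_Int_atMost_Suc)
  have cC: "card C + c = k + 1"
  proof -
    have "A = C \<union> (A \<inter> {..x})" "C \<inter> (A \<inter> {..x}) = {x}" using x by (auto simp: C_def)
    then show ?thesis
      using card_Un_Int[of C "A \<inter> {..x}"] finB fin by (simp add: k_def c_def)
  qed
  have "{0, x} \<subseteq> A \<inter> {..x}" using x assms by auto
  then have "card {0, x} \<le> c" unfolding c_def using fin by (intro card_mono) auto
  then have c2: "2 \<le> c" using x by simp
  have "a \<in> A - B" using x assms by (auto simp: B_def)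
  then have "B \<subset> A" by (auto simp: B_def)
  then have cBk: "card B < k" unfolding k_def using fin by (intro psubset_card_mono) auto
  have exa: "excess A a = int a - 2 * int k"
    using assms(4) by (simp add: excess_def k_def Int_absorb2)
  have exx: "excess A x = int x - 2 * int c" by (simp add: excess_def c_def)
  have exS: "excess A (Suc x) = int x - 2 * int c - 1" using x by (simp add: excess_Suc exx)
  have "Gcd B dvd x" "Gcd B dvd Suc x" using x by (auto simp: B_def)
  then have "Gcd B = 1" by (metis dvd_diff_nat diff_Suc_1' nat_dvd_1_iff_1 Suc_eq_plus1 add_diff_cancel_left')
  then have "min (3 * card B - 3) (card B + Max B) \<le> card (B + B)"
    using IH[of B] finB cBk assms by (auto simp: k_def B_def)
  moreover have "Max B = Suc x" using x finB by (intro Max_eqI) (auto simp: B_def)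
  \<comment> \<open>\<open>- 2 \<le> excess A x\<close> says exactly that
    \<open>3 * card B - 3\<close> is the smaller term of the minimum.\<close>
  ultimately have b1: "3 * card B - 3 \<le> card (B + B)" using ex exx cB by auto
  have "Gcd D = 1" using x by (intro Gcd_nat_eq_one) (auto simp: D_def)
  then have "min (3 * card D - 3) (card D + Max D) \<le> card (D + D)"
    using IH[of D] finD cardD cC c2 x by (auto simp: k_def D_def)
  moreover have "Max D = a - x"
  proof (rule Max_eqI[OF finD])
    show "n \<le> a - x" if "n \<in> D" for n
      using that assms(4) by (auto simp: D_def)
    show "a - x \<in> D" using x assms by (auto simp: D_def)
  qed
  \<comment> \<open>The same for the upper part: this inequality is
    \<open>excess A (Suc x) \<le> excess A a\<close> rewritten.\<close>
  moreover have "3 * card D - 3 \<le> card D + (a - x)"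
    using ex exa exS cC cardD x by linarith
  ultimately have "3 * card D - 3 \<le> card (D + D)" by auto
  moreover have "card (C + C) = card (D + D)"
    unfolding CD using sumset_affine_image[of x 1 D] by (simp add: card_image)
  ultimately have b2: "3 * card C - 3 \<le> card (C + C)" using cardD by simp
  have "B + B \<subseteq> A + A" "C + C \<subseteq> A + A" by (auto simp: B_def C_def elim!: set_plus_elim)
  then have "card ((B + B) \<union> (C + C)) \<le> card (A + A)"
    using fin by (intro card_mono finite_set_plus) auto
  moreover have "card ((B + B) \<union> (C + C)) + card ((B + B) \<inter> (C + C)) = card (B + B) + card (C + C)"
    using card_Un_Int[of "B + B" "C + C"] finB by (simp add: finite_set_plus)
  moreover have "card ((B + B) \<inter> (C + C)) \<le> card {2 * x .. 2 * x + 2}"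
  proof (intro card_mono)
    have "n \<le> 2 * x + 2" if "n \<in> B + B" for n
      using that by (auto simp: B_def elim!: set_plus_elim)
    moreover have "2 * x \<le> n" if "n \<in> C + C" for n
      using that by (auto simp: C_def elim!: set_plus_elim)
    ultimately show "(B + B) \<inter> (C + C) \<subseteq> {2 * x .. 2 * x + 2}" by auto
  qed simp
  \<comment> \<open>The two parts share two elements, which adds 6 to the sum of the two bounds;
    this pays for the second - 3 and for the three common sums.\<close>
  ultimately show ?thesis using b1 b2 cB cC cBk c2 by (simp add: k_def)
qed

section \<open>Sets that cannot be cut\<close>

text \<open>The hypotheses of \<open>card_sumset_split\<close> on \<open>x\<close> fail for every
  \<open>x\<close>.\<close>

definition no_split :: "nat set \<Rightarrow> nat \<Rightarrow> bool" where
  "no_split A a \<longleftrightarrow> (\<forall>x. x \<in> A \<longrightarrow> Suc x \<in> A \<longrightarrow> 0 < x \<longrightarrow> Suc x < a \<longrightarrow>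
     - 2 \<le> excess A x \<longrightarrow> \<not> excess A (Suc x) \<le> excess A a)"

text \<open>From - 1 the walk reaches - 2 only by a step down, that is, at an element of
  \<open>A\<close>. A second step down would be at consecutive elements with heights - 2 and - 3,
  the latter below \<open>excess A a\<close>: a forbidden cut.\<close>

lemma no_split_excess_ge:
  assumes ns: "no_split A a" and S: "- 2 \<le> excess A a"
    and M: "0 < M" "- 1 \<le> excess A M" and n: "M \<le> n" "n < a"
  shows "- 2 \<le> excess A n"
proof -
  have "n < a \<longrightarrow> - 2 \<le> excess A n \<and> (excess A n = - 2 \<longrightarrow> n \<in> A)"
    using n(1)
  proof (induction n rule: dec_induct)
    case base
    then show ?case using M by auto
  next
    case (step n)
    show ?case
    proof
      assume lt: "Suc n < a"
      then have h: "- 2 \<le> excess A n" "excess A n = - 2 \<longrightarrow> n \<in> A" using step by auto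
      have "Suc n \<notin> A" if "excess A n = - 2"
      proof
        assume "Suc n \<in> A"
        then have "excess A (Suc n) \<le> excess A a" using that S by (simp add: excess_Suc)
        then show False using ns lt h that \<open>Suc n \<in> A\<close> M step(1) unfolding no_split_def by auto
      qed
      then show "- 2 \<le> excess A (Suc n) \<and> (excess A (Suc n) = - 2 \<longrightarrow> Suc n \<in> A)"
        using h by (cases "excess A n = - 2") (auto simp: excess_Suc)
    qed
  qed
  then show ?thesis using n by auto
qed

text \<open>The mirror image of \<open>no_split_excess_ge\<close>, read backwards from
  \<open>Q\<close>: at height \<open>excess A a + 1\<close> the next step goes down. If the step
  into that height came down as well, these two steps would be consecutive elements forming a
  forbidden cut.\<close>

lemma no_split_excess_le:
  assumes ns: "no_split A a" and S: "- 2 \<le> excess A a"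
    and Q: "Q < a" "excess A Q \<le> excess A a" and n: "n \<le> Q"
  shows "excess A n \<le> excess A a + 1"
proof -
  have "excess A n \<le> excess A a + 1 \<and> (excess A n = excess A a + 1 \<longrightarrow> Suc n \<in> A \<and> n < Q)"
    using n
  proof (induction n rule: inc_induct)
    case base
    then show ?case using Q by auto
  next
    case (step n)
    have "Suc n \<notin> A" if eq: "excess A (Suc n) = excess A a + 1"
    proof
      assume "Suc n \<in> A"
      have "Suc (Suc n) \<in> A" "Suc n < Q" using step eq by auto
      moreover have "excess A (Suc (Suc n)) \<le> excess A a"
        using \<open>Suc (Suc n) \<in> A\<close> eq by (simp add: excess_Suc[of A "Suc n"])
      ultimately show False
        using ns \<open>Suc n \<in> A\<close> eq S Q unfolding no_split_def by auto
    qed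
    then show ?case using step
      by (cases "excess A (Suc n) = excess A a + 1") (auto simp: excess_Suc split: if_splits)
  qed
  then show ?thesis by blast
qed

text \<open>Before \<open>M\<close> pigeonhole from below makes everything a sum, beyond
  \<open>a + Q + 1\<close> pigeonhole from above does. Between \<open>M\<close> and \<open>Q\<close>
  both bounds on the walk hold, so consecutive elements would be a cut; hence \<open>A\<close> and
  \<open>1 + A\<close> are disjoint there.\<close>

lemma card_sumset_no_split_1:
  fixes A :: "nat set"
  assumes fin: "finite A" and "0 \<in> A" "1 \<in> A" "a \<in> A" "A \<subseteq> {..a}"
    and ns: "no_split A a" and S: "- 2 \<le> excess A a"
  shows "3 * card A - 3 \<le> card (A + A)"
proof -
  define S where "S = excess A a"
  define k where "k = card A"
  have Sk: "S = int a - 2 * int k"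
    using assms(5) by (simp add: excess_def S_def k_def Int_absorb2)
  have ex1: "excess A 1 = - 3" using excess_Suc[of A 0] assms by (simp add: excess_0)
  have "a \<noteq> 0" using assms by auto
  moreover have "a \<noteq> 1" using ex1 assms by auto
  ultimately have a2: "2 \<le> a" by linarith
  have exa1: "excess A (a - 1) = S + 1"
    using excess_Suc[of A "a - 1"] a2 assms by (simp add: S_def)
  define M where "M = (LEAST n. - 1 \<le> excess A n)"
  have "- 1 \<le> excess A (a - 1)" using exa1 assms by (simp add: S_def)
  then have M: "- 1 \<le> excess A M" "M \<le> a - 1"
    unfolding M_def by (rule LeastI, rule Least_le)
  have ltM: "excess A n \<le> - 2" if "n < M" for n
    using not_less_Least that unfolding M_def by fastforce
  have "M \<noteq> 0" using M(1) excess_0[OF \<open>0 \<in> A\<close>] by (intro notI) simp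
  moreover have "M \<noteq> 1" using M(1) ex1 by (intro notI) simp
  ultimately have M1: "1 < M" by linarith
  have "excess A (M - 1) \<le> - 2" using ltM M1 by simp
  then have exM: "excess A M = - 1" "M \<notin> A"
    using excess_Suc[of A "M - 1"] M M1 by (auto split: if_splits)
  define Q where "Q = Max {n. n < a \<and> excess A n \<le> S}"
  have "Q \<in> {n. n < a \<and> excess A n \<le> S}" unfolding Q_def
  proof (rule Max_in)
    have "0 \<in> {n. n < a \<and> excess A n \<le> S}" using assms a2 by (auto simp: excess_0 S_def)
    then show "{n. n < a \<and> excess A n \<le> S} \<noteq> {}" by blast
  qed simp
  then have Q: "Q < a" "excess A Q \<le> S" by auto
  have gtQ: "S + 1 \<le> excess A n" if "Q < n" "n < a" for n
  proof (rule ccontr)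
    assume "\<not> ?thesis"
    then have "n \<in> {n. n < a \<and> excess A n \<le> S}" using that by auto
    then have "n \<le> Q" unfolding Q_def by (intro Max_ge) auto
    then show False using that by simp
  qed
  have Qa: "Suc Q < a"
  proof (rule ccontr)
    assume "\<not> Suc Q < a"
    then have "Q = a - 1" using Q by auto
    then show False using exa1 Q by auto
  qed
  then have "S + 1 \<le> excess A (Suc Q)" using gtQ by auto
  then have exQ: "excess A Q = S" "Suc Q \<notin> A"
    using excess_Suc[of A Q] Q by (auto split: if_splits)
  have iso: "Suc x \<notin> A" if x: "x \<in> A" "M < x" "x \<le> Q" for x
  proof
    assume sx: "Suc x \<in> A"
    have "- 2 \<le> excess A x"
      using no_split_excess_ge[OF ns assms(7), of M x] M M1 x Q by simp
    moreover have "excess A x \<le> S + 1"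
      using no_split_excess_le[OF ns assms(7), of Q x] x Q by (simp add: S_def)
    then have "excess A (Suc x) \<le> S" using sx by (simp add: excess_Suc)
    moreover have "x \<noteq> Q" using sx exQ by auto
    ultimately show False using ns x sx Q unfolding no_split_def S_def by auto
  qed
  \<comment> \<open>Five disjoint pieces of \<open>A + A\<close> whose sizes add up to at least \<open>3 * k - 3\<close>; the choice of \<open>M\<close> and \<open>Q\<close>
    makes the counting function of \<open>A\<close> known there, and \<open>iso\<close> separates \<open>P3\<close> from \<open>P2\<close>.\<close>
  define P1 where "P1 = {..<M}"
  define P2 where "P2 = A \<inter> {M<..a}"
  define P3 where "P3 = Suc ` (A \<inter> {M<..Q})"
  define P4 where "P4 = (\<lambda>x. a + x) ` (A \<inter> {0<..Q})"
  define P5 where "P5 = {a + Q + 2..2 * a}"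
  have "P1 \<subseteq> A + A" using ltM mem_sumset_if_excess by (auto simp: P1_def)
  moreover have "P2 \<subseteq> A + A"
  proof
    fix x assume "x \<in> P2"
    then have "0 + x \<in> A + A" using \<open>0 \<in> A\<close> by (intro set_plus_intro) (auto simp: P2_def)
    then show "x \<in> A + A" by simp
  qed
  moreover have "P3 \<subseteq> A + A"
  proof
    fix y assume "y \<in> P3"
    then obtain x where x: "x \<in> A" "y = 1 + x" by (auto simp: P3_def)
    show "y \<in> A + A" unfolding x(2) using x \<open>1 \<in> A\<close> by (intro set_plus_intro)
  qed
  moreover have "P4 \<subseteq> A + A" using \<open>a \<in> A\<close> by (auto simp: P4_def intro: set_plus_intro)
  moreover have "P5 \<subseteq> A + A"
  proof
    fix n assume n: "n \<in> P5"
    \<comment> \<open>Past \<open>Q\<close> the walk is above its final value \<open>S\<close>, so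
      \<open>A\<close> fills more than half of \<open>{Suc j..a}\<close>.\<close>
    define j where "j = n - a - 1"
    have j: "Q < j" "j < a" "n = Suc j + a" using n by (auto simp: P5_def j_def)
    have "A \<inter> {Suc j..a} = A \<inter> {j<..a}" by auto
    then have "card (A \<inter> {Suc j..a}) + card (A \<inter> {..j}) = k"
      using card_Int_atMost_diff[OF fin, of j a] j assms(5) by (simp add: k_def Int_absorb2)
    moreover have "S + 1 \<le> int j - 2 * int (card (A \<inter> {..j}))"
      using gtQ[OF j(1,2)] by (simp add: excess_def)
    ultimately have "a + 1 < 2 * card (A \<inter> {Suc j..a}) + Suc j" using Sk by linarith
    then show "n \<in> A + A" using add_mem_sumset_if_dense[of "Suc j" a A] j by simp
  qed
  ultimately have "P1 \<union> P2 \<union> P3 \<union> P4 \<union> P5 \<subseteq> A + A" by simp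
  then have le: "card (P1 \<union> P2 \<union> P3 \<union> P4 \<union> P5) \<le> card (A + A)"
    using fin by (intro card_mono finite_set_plus)
  have fins: "finite P1" "finite P2" "finite P3" "finite P4" "finite P5"
    using fin by (auto simp: P1_def P2_def P3_def P4_def P5_def)
  have "card (P1 \<union> P2 \<union> P3 \<union> P4 \<union> P5) = card (P1 \<union> P2 \<union> P3 \<union> P4) + card P5"
    using fins M Qa by (intro card_Un_disjoint) (auto simp: P1_def P2_def P3_def P4_def P5_def)
  also have "card (P1 \<union> P2 \<union> P3 \<union> P4) = card (P1 \<union> P2 \<union> P3) + card P4"
    using fins M Qa by (intro card_Un_disjoint) (auto simp: P1_def P2_def P3_def P4_def)
  also have "card (P1 \<union> P2 \<union> P3) = card (P1 \<union> P2) + card P3"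
    using fins iso by (intro card_Un_disjoint) (auto simp: P1_def P2_def P3_def)
  also have "card (P1 \<union> P2) = card P1 + card P2"
    using fins by (intro card_Un_disjoint) (auto simp: P1_def P2_def)
  finally have sum: "card (P1 \<union> P2 \<union> P3 \<union> P4 \<union> P5) = card P1 + card P2 + card P3 + card P4 + card P5" .
  have c1: "card P1 = M" by (simp add: P1_def)
  have c2: "card P2 + card (A \<inter> {..M}) = k"
    using card_Int_atMost_diff[OF fin, of M a] M assms(5) by (simp add: k_def P2_def Int_absorb2)
  \<comment> \<open>Only an inequality, since \<open>Q\<close> is not known to lie beyond
    \<open>M\<close>; if it does not, \<open>P3\<close> is empty.\<close>
  have c3: "card (A \<inter> {..Q}) \<le> card P3 + card (A \<inter> {..M})"
  proof -
    have "A \<inter> {..Q} \<subseteq> (A \<inter> {M<..Q}) \<union> (A \<inter> {..M})" by auto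
    then have "card (A \<inter> {..Q}) \<le> card ((A \<inter> {M<..Q}) \<union> (A \<inter> {..M}))"
      using fin by (intro card_mono) auto
    also have "\<dots> \<le> card (A \<inter> {M<..Q}) + card (A \<inter> {..M})" by (rule card_Un_le)
    also have "card (A \<inter> {M<..Q}) = card P3" by (simp add: P3_def card_image)
    finally show ?thesis .
  qed
  have c4: "card P4 + 1 = card (A \<inter> {..Q})"
  proof -
    have "card P4 = card (A \<inter> {0<..Q})" by (simp add: P4_def card_image)
    moreover have "A \<inter> {..0} = {0}" using assms by auto
    ultimately show ?thesis using card_Int_atMost_diff[OF fin, of 0 Q] by simp
  qed
  have c5: "card P5 + Q + 1 = a" using Qa by (simp add: P5_def)
  have "2 * card (A \<inter> {..M}) = M + 1" using exM by (simp add: excess_def)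
  moreover have "int Q - 2 * int (card (A \<inter> {..Q})) = int a - 2 * int k"
    using exQ Sk by (simp add: excess_def)
  \<comment> \<open>The known values of the walk at \<open>M\<close> and \<open>Q\<close> make all
    terms in \<open>M\<close>, \<open>Q\<close> and \<open>a\<close> cancel, which leaves
    \<open>3 * k - 3\<close>.\<close>
  ultimately show ?thesis using le sum c1 c2 c3 c4 c5 unfolding k_def by linarith
qed

section \<open>Removing the largest element, and Freiman's theorem\<close>

lemma Gcd_reflect:
  fixes A :: "nat set"
  assumes "0 \<in> A" "A \<subseteq> {..a}" "a \<in> A"
  shows "Gcd ((\<lambda>x. a - x) ` A) = Gcd A"
proof (rule dvd_antisym)
  let ?g = "Gcd ((\<lambda>x. a - x) ` A)"
  show "?g dvd Gcd A"
  proof (rule Gcd_greatest)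
    fix x assume x: "x \<in> A"
    have "?g dvd a - 0" "?g dvd a - x" using x assms by (blast intro: Gcd_dvd)+
    moreover have "x = (a - 0) - (a - x)" using x assms by auto
    ultimately show "?g dvd x" by (metis dvd_diff_nat)
  qed
  show "Gcd A dvd ?g" using assms by (intro Gcd_greatest) (auto intro!: dvd_diff_nat)
qed

text \<open>One element less costs 3 in the bound. If the gcd of \<open>B\<close> is not 1, then
  \<open>a\<close> is not divisible by it, so the whole translate \<open>a + A\<close> is new and
  the trivial bound for \<open>B + B\<close> suffices. If it is 1, three new sums are found.\<close>

lemma card_sumset_remove_Max:
  fixes A :: "nat set"
  assumes fin: "finite A" and "0 \<in> A" "a \<in> A" "A \<subseteq> {..a}" "0 < a" and gcd: "Gcd A = 1"
    and "a - 1 \<notin> A"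
    and IH: "Gcd (A - {a}) = 1 \<Longrightarrow> 3 * card (A - {a}) - 3 \<le> card ((A - {a}) + (A - {a}))"
  shows "3 * card A - 3 \<le> card (A + A)"
proof -
  define B where "B = A - {a}"
  have finB: "finite B" using fin by (simp add: B_def)
  have cB: "card A = card B + 1" using card_Suc_Diff1[OF fin \<open>a \<in> A\<close>] by (simp add: B_def)
  have B0: "0 \<in> B" and Ba: "\<And>x. x \<in> B \<Longrightarrow> x < a" using assms by (auto simp: B_def)
  have sub: "B + B \<subseteq> A + A" by (auto simp: B_def elim!: set_plus_elim)
  show ?thesis
  proof (cases "Gcd B = 1")
    case False
    have disj: "(B + B) \<inter> (\<lambda>x. a + x) ` A = {}"
    proof (rule ccontr)
      assume "\<not> ?thesis"
      then obtain x y z where xyz: "x \<in> B" "y \<in> B" "z \<in> A" "x + y = a + z"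
        by (auto elim!: set_plus_elim)
      then have "z \<noteq> a" using Ba[of x] Ba[of y] by auto
      then have "z \<in> B" using xyz by (simp add: B_def)
      then have "Gcd B dvd a"
        using xyz by (metis Gcd_dvd dvd_add dvd_add_left_iff)
      then have "Gcd B dvd Gcd A" using Gcd_dvd[of _ B] unfolding B_def
        by (intro Gcd_greatest) (metis Diff_iff singletonD)
      then show False using False gcd by simp
    qed
    have "(B + B) \<union> (\<lambda>x. a + x) ` A \<subseteq> A + A" using sub \<open>a \<in> A\<close> by (auto intro: set_plus_intro)
    then have "card ((B + B) \<union> (\<lambda>x. a + x) ` A) \<le> card (A + A)"
      using fin by (intro card_mono finite_set_plus)
    moreover have "card ((B + B) \<union> (\<lambda>x. a + x) ` A) = card (B + B) + card A"
      using disj fin finB by (simp add: card_Un_disjoint finite_set_plus card_image)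
    moreover have "2 * card B \<le> card (B + B) + 1" using finB B0 by (intro card_sumset_ge) auto
    ultimately show ?thesis using cB by simp
  next
    case True
    then have bB: "3 * card B - 3 \<le> card (B + B)" using IH by (simp add: B_def)
    define b where "b = Max B"
    have b: "b \<in> B" "\<And>x. x \<in> B \<Longrightarrow> x \<le> b" using finB B0 by (auto simp: b_def intro!: Max_in)
    have ba: "b < a" using Ba b by auto
    have BB2b: "n \<le> 2 * b" if "n \<in> B + B" for n
    proof -
      obtain x y where "x \<in> B" "y \<in> B" "n = x + y" using \<open>n \<in> B + B\<close> by (elim set_plus_elim)
      then show ?thesis using b(2)[of x] b(2)[of y] by simp
    qed
    \<comment> \<open>\<open>a + a\<close> and \<open>a + b\<close> exceed \<open>2 * b\<close> and
      are new anyway; the third new sum has to come from some \<open>a + x\<close>.\<close>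
    have "\<exists>x\<in>B. x < b \<and> a + x \<notin> B + B"
    proof (rule ccontr)
      assume neg: "\<not> ?thesis"
      \<comment> \<open>Otherwise every \<open>a - x\<close> beyond \<open>0\<close> and \<open>a - b\<close> is a sum of two smaller positive ones.\<close>
      have dvd: "(a - b) dvd (a - x)" if "x \<in> A" for x
        using that
      proof (induction "a - x" arbitrary: x rule: less_induct)
        case less
        consider "x = a" | "x = b" | "x \<in> B" "x < b"
          using less(2) b(2) by (auto simp: B_def order_less_le)
        then show ?case
        proof cases
          case 3
          then have "a + x \<in> B + B" using neg by blast
          then obtain y z where yz: "y \<in> B" "z \<in> B" "a + x = y + z" by (auto elim!: set_plus_elim)
          then have lt: "y < a" "z < a" using Ba by auto
          then have "a - y < a - x" "a - z < a - x" "a - x = (a - y) + (a - z)" using yz by linarith+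
          moreover have "y \<in> A" "z \<in> A" using yz by (auto simp: B_def)
          ultimately show ?thesis using less(1) by (metis dvd_add)
        qed auto
      qed
      have "(a - b) dvd Gcd ((\<lambda>x. a - x) ` A)" using dvd by (intro Gcd_greatest) auto
      then have "a - b = 1" using gcd Gcd_reflect[OF assms(2,4,3)] by simp
      then have "b = a - 1" using ba by simp
      then show False using b(1) \<open>a - 1 \<notin> A\<close> by (simp add: B_def)
    qed
    then obtain x where x: "x \<in> B" "x < b" "a + x \<notin> B + B" by blast
    have "(B + B) \<union> {a + x, a + b, a + a} \<subseteq> A + A"
      using sub x b \<open>a \<in> A\<close> by (auto simp: B_def intro!: set_plus_intro)
    then have "card ((B + B) \<union> {a + x, a + b, a + a}) \<le> card (A + A)"
      using fin by (intro card_mono finite_set_plus)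
    moreover have "card ((B + B) \<union> {a + x, a + b, a + a}) = card (B + B) + card {a + x, a + b, a + a}"
    proof (intro card_Un_disjoint)
      have "a + b \<notin> B + B" "a + a \<notin> B + B" using BB2b ba by fastforce+
      then show "(B + B) \<inter> {a + x, a + b, a + a} = {}" using x by auto
    qed (use finB in \<open>auto simp: finite_set_plus\<close>)
    moreover have "card {a + x, a + b, a + a} = 3" using x ba by simp
    ultimately show ?thesis using bB cB by linarith
  qed
qed

text \<open>The second term is the minimum exactly if \<open>a + 3 \<le> 2 * card A\<close>, the
  dense case. Otherwise, if 1 or, after reflection, \<open>a - 1\<close> is in the set, either a cut
  or the direct count applies; if neither is, either a cut or the removal of
  \<open>a\<close>.\<close>

theorem card_sumset_Freiman:
  fixes A :: "nat set"
  assumes "finite A" "0 \<in> A" "Gcd A = 1"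
  shows "min (3 * card A - 3) (card A + Max A) \<le> card (A + A)"
  using assms
proof (induction "card A" arbitrary: A rule: less_induct)
  case (less A)
  define a where "a = Max A"
  have "A \<noteq> {}" using less.prems by auto
  then have a: "a \<in> A" "A \<subseteq> {..a}" using less.prems by (auto simp: a_def)
  have IH: "min (3 * card B - 3) (card B + Max B) \<le> card (B + B)"
    if "finite B" "card B < card A" "0 \<in> B" "Gcd B = 1" for B
    using less.hyps that by blast
  show ?case
  proof (cases "a + 3 \<le> 2 * card A")
    case True
    then show ?thesis
      using card_sumset_dense[OF less.prems(1,2) a True] by (simp add: a_def)
  next
    case False
    have exc: "excess B a = int a - 2 * int (card B)" if "B \<subseteq> {..a}" for B
      using that by (simp add: excess_def Int_absorb2)
    have main: "3 * card B - 3 \<le> card (B + B)"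
      if B: "finite B" "0 \<in> B" "1 \<in> B" "a \<in> B" "B \<subseteq> {..a}" "card B = card A" for B
    proof (cases "no_split B a")
      case True
      then show ?thesis using card_sumset_no_split_1[OF B(1-5)] exc[OF B(5)] False B(6) by simp
    next
      case no: False
      then obtain x where x: "x \<in> B" "Suc x \<in> B" "0 < x" "Suc x < a" "- 2 \<le> excess B x"
        "excess B (Suc x) \<le> excess B a" unfolding no_split_def by blast
      show ?thesis
        by (rule card_sumset_split[OF B(1,2,4,5) x]) (use IH B(6) in auto)
    qed
    have "3 * card A - 3 \<le> card (A + A)"
    proof (cases "1 \<in> A")
      case True
      then show ?thesis using main[of A] less.prems a by auto
    next
      case A1: False
      have "a \<noteq> 0"
      proof
        assume "a = 0"
        then have "A = {0}" using a by auto
        then show False using less.prems by simp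
      qed
      show ?thesis
      proof (cases "a - 1 \<in> A")
        case True
        define B where "B = (\<lambda>x. a - x) ` A"
        have inj: "inj_on (\<lambda>x. a - x) A" 
        proof (rule inj_onI)
          fix x y assume "x \<in> A" "y \<in> A" "a - x = a - y"
          moreover have "x \<le> a" "y \<le> a" using calculation a by auto
          ultimately show "x = y" by linarith
        qed
        have "1 \<in> B" "0 \<in> B" "a \<in> B"
          using imageI[OF True, of "\<lambda>x. a - x"] imageI[OF a(1), of "\<lambda>x. a - x"]
            imageI[OF less.prems(2), of "\<lambda>x. a - x"] \<open>a \<noteq> 0\<close> by (simp_all add: B_def)
        moreover have "card B = card A" using inj by (simp add: B_def card_image)
        moreover have "finite B" "B \<subseteq> {..a}" using less.prems by (auto simp: B_def)
        ultimately have "3 * card B - 3 \<le> card (B + B)" using main by blast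
        then show ?thesis
          using card_sumset_reflect[OF a(2)] \<open>card B = card A\<close> by (simp add: B_def)
      next
        case a1: False
        show ?thesis
        proof (cases "no_split A a")
          case no: False
          then obtain x where x: "x \<in> A" "Suc x \<in> A" "0 < x" "Suc x < a" "- 2 \<le> excess A x"
            "excess A (Suc x) \<le> excess A a" unfolding no_split_def by blast
          show ?thesis by (rule card_sumset_split[OF less.prems(1,2) a x IH])
        next
          case True
          show ?thesis
          proof (rule card_sumset_remove_Max[OF less.prems(1,2) a _ less.prems(3) a1])
            show "0 < a" using \<open>a \<noteq> 0\<close> by simp
            assume g: "Gcd (A - {a}) = 1"
            define B where "B = A - {a}"
            have B: "finite B" "0 \<in> B" "card A = card B + 1"
              using less.prems \<open>a \<noteq> 0\<close> card_Suc_Diff1[OF less.prems(1) a(1)] by (auto simp: B_def)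
            define b where "b = Max B"
            have b: "b \<in> B" "B \<subseteq> {..b}" using B by (auto simp: b_def intro!: Max_in)
            have "b < a" using b a by (force simp: B_def)
            have "b \<noteq> 0"
            proof
              assume "b = 0"
              then have "B = {0}" using b by auto
              then show False using g by (simp add: B_def)
            qed
            \<comment> \<open>As 1 is missing, the walk is already at - 1 at position 1 and stays at
              least - 2 up to \<open>b\<close>. This makes \<open>3 * card B - 3\<close> the smaller
              term for \<open>B\<close>, as the removal lemma requires.\<close>
            have "excess A 1 = - 1" using excess_Suc[of A 0] A1 less.prems by (simp add: excess_0)
            then have "- 2 \<le> excess A b"
              using no_split_excess_ge[OF True, of 1 b] exc[OF a(2)] False \<open>b \<noteq> 0\<close> \<open>b < a\<close> by simp
            moreover have "A \<inter> {..b} = B" using b \<open>b < a\<close> by (auto simp: B_def)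
            ultimately have "2 * card B \<le> b + 2" by (simp add: excess_def)
            moreover have "min (3 * card B - 3) (card B + b) \<le> card (B + B)"
              using IH[of B] B g by (simp add: B_def b_def)
            ultimately show "3 * card (A - {a}) - 3 \<le> card ((A - {a}) + (A - {a}))"
              unfolding B_def[symmetric] by linarith
          qed
        qed
      qed
    qed
    then show ?thesis by linarith
  qed
qed

section \<open>Upper and lower densities\<close>

abbreviation count_upto :: "nat set \<Rightarrow> nat \<Rightarrow> nat" where
  "count_upto A n \<equiv> card (A \<inter> {1..n})"

lemma count_upto_le: "count_upto A n \<le> n"
  using card_mono[of "{1..n}" "A \<inter> {1..n}"] by simp

lemma upper_density_nonneg: "0 \<le> upper_density A"
proof -
  have "ereal 0 \<le> limsup (\<lambda>n. ereal (real (count_upto A n) / real n))"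
    by (rule le_Limsup) auto
  then show ?thesis unfolding ereal_upper_density[symmetric] by simp
qed

lemma upper_density_le_1: "upper_density A \<le> 1"
proof -
  have "limsup (\<lambda>n. ereal (real (count_upto A n) / real n)) \<le> ereal 1"
    by (intro Limsup_bounded always_eventually allI) (use density_quotient_bounds(2) in simp)
  then show ?thesis unfolding ereal_upper_density[symmetric] by simp
qed

lemma lower_density_bounds: "lower_density A \<in> {0..1}"
proof -
  have "ereal 0 \<le> liminf (\<lambda>n. ereal (real (count_upto A n) / real n))"
    by (rule Liminf_bounded) auto
  moreover have "liminf (\<lambda>n. ereal (real (count_upto A n) / real n)) \<le>
    limsup (\<lambda>n. ereal (real (count_upto A n) / real n))" by (rule Liminf_le_Limsup) simp
  ultimately show ?thesis
    using upper_density_le_1[of A] unfolding ereal_upper_density[symmetric] ereal_lower_density[symmetric] by simp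
qed

section \<open>Epsilon criteria for densities\<close>

text \<open>Here and in the next criteria the quotient is multiplied out: counting then yields
  linear inequalities, and the default value at \<open>n = 0\<close> disappears.\<close>

lemma upper_density_leI:
  assumes "\<And>e. 0 < e \<Longrightarrow> \<forall>\<^sub>F n in sequentially. real (count_upto A n) \<le> (d + e) * real n"
  shows "upper_density A \<le> d"
proof (rule field_le_epsilon)
  fix e :: real assume "0 < e"
  have "\<forall>\<^sub>F n in sequentially. ereal (real (count_upto A n) / real n) \<le> ereal (d + e)"
    using assms[OF \<open>0 < e\<close>] eventually_gt_at_top[of 0]
    by eventually_elim (simp add: divide_le_eq)
  then have "limsup (\<lambda>n. ereal (real (count_upto A n) / real n)) \<le> ereal (d + e)"
    by (rule Limsup_bounded)
  then show "upper_density A \<le> d + e" unfolding ereal_upper_density[symmetric] by simp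
qed

lemma upper_density_less_eventually:
  assumes "upper_density A < d"
  shows "\<forall>\<^sub>F n in sequentially. real (count_upto A n) \<le> d * real n"
proof -
  have "limsup (\<lambda>n. ereal (real (count_upto A n) / real n)) < ereal d"
    using assms unfolding ereal_upper_density[symmetric] by simp
  from Limsup_lessD[OF this] eventually_gt_at_top[of 0] show ?thesis
    by eventually_elim (simp add: divide_less_eq)
qed

lemma upper_density_geI:
  assumes "\<And>e. 0 < e \<Longrightarrow> \<exists>\<^sub>F n in sequentially. (d - e) * real n \<le> real (count_upto A n)"
  shows "d \<le> upper_density A"
proof (rule ccontr)
  assume "\<not> d \<le> upper_density A"
  define e where "e = (d - upper_density A) / 3"
  have e: "0 < e" "upper_density A < d - 2 * e"
    using \<open>\<not> d \<le> upper_density A\<close> by (auto simp: e_def field_simps)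
  have "\<forall>\<^sub>F n in sequentially. \<not> (d - e) * real n \<le> real (count_upto A n)"
    using upper_density_less_eventually[OF e(2)] eventually_gt_at_top[of 0]
  proof eventually_elim
    case (elim n)
    then have "0 < e * real n" using e by simp
    with elim show ?case by (simp add: algebra_simps)
  qed
  then show False using assms[OF e(1)] by (simp add: frequently_def)
qed

lemma upper_density_greater_frequently:
  assumes "d < upper_density A"
  shows "\<exists>\<^sub>F n in sequentially. d * real n \<le> real (count_upto A n)"
proof (rule ccontr)
  assume "\<not> ?thesis"
  then have "\<forall>\<^sub>F n in sequentially. real (count_upto A n) \<le> d * real n"
    unfolding frequently_def not_not by (rule eventually_mono) simp
  then have "\<forall>\<^sub>F n in sequentially. ereal (real (count_upto A n) / real n) \<le> ereal d"
    using eventually_gt_at_top[of 0] by eventually_elim (simp add: divide_le_eq)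
  then have "limsup (\<lambda>n. ereal (real (count_upto A n) / real n)) \<le> ereal d"
    by (rule Limsup_bounded)
  then show False using assms unfolding ereal_upper_density[symmetric] by simp
qed

lemma lower_density_geI:
  assumes "\<And>e. 0 < e \<Longrightarrow> \<forall>\<^sub>F n in sequentially. (d - e) * real n \<le> real (count_upto A n)"
  shows "d \<le> lower_density A"
proof (rule field_le_epsilon)
  fix e :: real assume "0 < e"
  have "\<forall>\<^sub>F n in sequentially. ereal (d - e) \<le> ereal (real (count_upto A n) / real n)"
    using assms[OF \<open>0 < e\<close>] eventually_gt_at_top[of 0]
    by eventually_elim (simp add: le_divide_eq)
  then have "ereal (d - e) \<le> liminf (\<lambda>n. ereal (real (count_upto A n) / real n))"
    by (rule Liminf_bounded)
  then show "d \<le> lower_density A + e" unfolding ereal_lower_density[symmetric] by simp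
qed

lemma lower_density_leI:
  assumes "\<And>e. 0 < e \<Longrightarrow> \<exists>\<^sub>F n in sequentially. real (count_upto A n) \<le> (d + e) * real n"
  shows "lower_density A \<le> d"
proof (rule ccontr)
  assume "\<not> lower_density A \<le> d"
  define e where "e = (lower_density A - d) / 2"
  have e: "0 < e" "d + e < lower_density A"
    using \<open>\<not> lower_density A \<le> d\<close> by (auto simp: e_def field_simps)
  have "ereal (d + e) < liminf (\<lambda>n. ereal (real (count_upto A n) / real n))"
    using e unfolding ereal_lower_density[symmetric] by simp
  from less_LiminfD[OF this] eventually_gt_at_top[of 0]
  have "\<forall>\<^sub>F n in sequentially. \<not> real (count_upto A n) \<le> (d + e) * real n"
    by eventually_elim (simp add: less_divide_eq)
  then show False using assms[OF e(1)] by (simp add: frequently_def)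
qed

section \<open>Affine normal form and the lower bound for the sumset\<close>

text \<open>The image up to \<open>n\<close> corresponds to \<open>B\<close> up to about
  \<open>n / g\<close>; the bounded errors from \<open>c\<close> and from rounding are absorbed by
  the second half of \<open>e\<close>.\<close>

lemma upper_density_affine_image:
  fixes B :: "nat set"
  assumes g: "0 < g"
  shows "upper_density ((\<lambda>b. c + g * b) ` B) = upper_density B / real g"
proof (rule antisym)
  let ?A = "(\<lambda>b. c + g * b) ` B"
  define d where "d = upper_density B"
  have inj: "inj_on (\<lambda>b. c + g * b) X" for X using g by (intro inj_onI) auto
  show "upper_density ?A \<le> upper_density B / real g"
  proof (rule upper_density_leI)
    fix e :: real assume e: "0 < e"
    have "upper_density B < d + e * real g / 2" using e g by (simp add: d_def)
    from upper_density_less_eventually[OF this]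
    obtain n0 where n0: "\<And>n. n0 \<le> n \<Longrightarrow> real (count_upto B n) \<le> (d + e * real g / 2) * real n"
      by (auto simp: eventually_sequentially)
    have "\<forall>\<^sub>F n in sequentially. max (real (n0 * g)) (2 / e) \<le> real n"
      using filterlim_real_sequentially unfolding filterlim_at_top by blast
    then show "\<forall>\<^sub>F n in sequentially. real (count_upto ?A n) \<le> (upper_density B / real g + e) * real n"
    proof eventually_elim
      case (elim n)
      then have n: "n0 * g \<le> n" "2 \<le> e * real n"
        using e by (simp_all only: max.bounded_iff of_nat_le_iff) (simp add: field_simps)
      have nd: "n0 \<le> n div g" using n g by (simp add: less_eq_div_iff_mult_less_eq)
      \<comment> \<open>0 is inserted because \<open>b = 0\<close> can contribute the positive
        element \<open>c\<close> on the left, whereas \<open>count_upto B\<close> never counts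
        0.\<close>
      have "?A \<inter> {1..n} \<subseteq> (\<lambda>b. c + g * b) ` (insert 0 (B \<inter> {1..n div g}))"
      proof
        fix x assume "x \<in> ?A \<inter> {1..n}"
        then obtain b where b: "b \<in> B" "x = c + g * b" "x \<le> n" by auto
        then have "b * g \<le> n" by (simp add: mult.commute)
        then have "b \<le> n div g" using g by (simp add: less_eq_div_iff_mult_less_eq)
        then have "b \<in> insert 0 (B \<inter> {1..n div g})" using b by auto
        then show "x \<in> (\<lambda>b. c + g * b) ` (insert 0 (B \<inter> {1..n div g}))" using b by blast
      qed
      then have "count_upto ?A n \<le> card ((\<lambda>b. c + g * b) ` (insert 0 (B \<inter> {1..n div g})))"
        by (intro card_mono) auto
      also have "\<dots> \<le> count_upto B (n div g) + 1"
        by (subst card_image[OF inj]) (simp add: card_insert_if)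
      finally have "real (count_upto ?A n) \<le> (d + e * real g / 2) * real (n div g) + 1"
        using n0[OF nd] by simp
      also have "\<dots> \<le> (d + e * real g / 2) * (real n / real g) + 1"
        using of_nat_div_le_of_nat[of n g, where 'a = real] e upper_density_nonneg[of B]
        by (intro add_right_mono mult_left_mono) (auto simp: d_def)
      also have "\<dots> \<le> (d / real g + e) * real n"
        using n(2) g by (simp add: field_simps)
      finally show ?case by (simp add: d_def)
    qed
  qed
  show "upper_density B / real g \<le> upper_density ?A"
  proof (rule upper_density_geI)
    fix e :: real assume e: "0 < e"
    have "d - e * real g / 2 < upper_density B" using e g by (simp add: d_def)
    then have fr: "\<exists>\<^sub>F n in sequentially. (d - e * real g / 2) * real n \<le> real (count_upto B n)"
      by (rule upper_density_greater_frequently)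
    show "\<exists>\<^sub>F n in sequentially. (upper_density B / real g - e) * real n \<le> real (count_upto ?A n)"
      unfolding frequently_sequentially
    proof
      fix N
      obtain n where n: "n \<ge> max N (nat \<lceil>2 * real c / e\<rceil>)"
        "(d - e * real g / 2) * real n \<le> real (count_upto B n)"
        using fr unfolding frequently_sequentially by blast
      have "2 * real c / e \<le> real n" using n by linarith
      then have nc: "2 * real c \<le> e * real n" using e by (simp add: field_simps)
      have "(\<lambda>b. c + g * b) ` (B \<inter> {1..n}) \<subseteq> ?A \<inter> {1..c + g * n}" using g by (auto simp: Suc_le_eq)
      then have "card ((\<lambda>b. c + g * b) ` (B \<inter> {1..n})) \<le> count_upto ?A (c + g * n)"
        by (intro card_mono) auto
      then have "count_upto B n \<le> count_upto ?A (c + g * n)" by (simp add: card_image[OF inj])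
      then have 1: "(d - e * real g / 2) * real n \<le> real (count_upto ?A (c + g * n))"
        using n(2) by linarith
      have "d \<le> 1" using upper_density_le_1 by (simp add: d_def)
      have "(d / real g - e) * real (c + g * n) = d * real c / real g + d * real n - e * real c - e * real g * real n"
        using g by (simp add: field_simps)
      also have "d * real c / real g \<le> 1 * real c / 1"
        using \<open>d \<le> 1\<close> g upper_density_nonneg[of B] by (intro frac_le mult_right_mono) (auto simp: d_def)
      also have "1 * real c / 1 \<le> e * real g * real n / 2"
      proof -
        have "e * real n * 1 \<le> e * real n * real g" using e g by (intro mult_left_mono) auto
        then show ?thesis using nc by (simp add: mult_ac)
      qed
      also have "e * real g * real n / 2 + d * real n - e * real c - e * real g * real n \<le> (d - e * real g / 2) * real n"
        using e by (simp add: algebra_simps)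
      finally have "(d / real g - e) * real (c + g * n) \<le> (d - e * real g / 2) * real n"
        by simp
      with 1 have "(d / real g - e) * real (c + g * n) \<le> real (count_upto ?A (c + g * n))" by linarith
      moreover have "N \<le> c + g * n" using n(1) g
        by (metis One_nat_def Suc_leI le_add2 max.boundedE mult_le_mono1 nat_mult_1 order_trans)
      ultimately show "\<exists>n\<ge>N. (upper_density B / real g - e) * real n \<le> real (count_upto ?A n)"
        unfolding d_def by blast
    qed
  qed
qed

text \<open>The gcds of growing initial segments form a decreasing chain of divisors. It becomes
  constant, and the final value divides every element of \<open>B\<close>.\<close>

lemma Gcd_Int_atMost_eq_1:
  fixes B :: "nat set"
  assumes "Gcd B = 1"
  obtains n0 where "\<And>n. n0 \<le> n \<Longrightarrow> Gcd (B \<inter> {..n}) = 1"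
proof -
  define G where "G n = Gcd (B \<inter> {..n})" for n
  \<comment> \<open>Minimising only from a positive element on keeps the gcds positive; the gcd of
    \<open>{}\<close> or \<open>{0}\<close> is 0 and would be a false minimum.\<close>
  obtain b where b: "b \<in> B" "0 < b"
    using assms Gcd_0_iff[of B] by (metis gr0I one_neq_zero singleton_iff subsetI)
  define n0 where "n0 = arg_min G (\<lambda>n. b \<le> n)"
  have n0: "b \<le> n0" "\<And>n. b \<le> n \<Longrightarrow> G n0 \<le> G n"
    unfolding n0_def using arg_min_nat_lemma[of "\<lambda>n. b \<le> n" b G] by auto
  have pos: "0 < G n" if "b \<le> n" for n
  proof -
    have "G n dvd b" unfolding G_def using that b by (intro Gcd_dvd) auto
    then show ?thesis using b by (auto intro: gr0I)
  qed
  have dvd: "G n dvd G m" if "m \<le> n" for m n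
    unfolding G_def using that by (intro Gcd_greatest Gcd_dvd) auto
  have eq: "G n = G n0" if "n0 \<le> n" for n
    using dvd_imp_le[OF dvd[OF that] pos[OF n0(1)]] n0(2)[of n] that n0(1) by simp
  have "G n0 dvd Gcd B"
  proof (rule Gcd_greatest)
    fix x assume "x \<in> B"
    then have "G (max n0 x) dvd x" unfolding G_def by (intro Gcd_dvd) auto
    then show "G n0 dvd x" using eq[of "max n0 x"] by simp
  qed
  then have "G n0 = 1" using assms by simp
  then show ?thesis using that[of n0] eq by (simp add: G_def)
qed

text \<open>The sums of elements up to \<open>a\<close> are at most \<open>2 * a\<close>, so
  Freiman's bound is compared with \<open>2 * a\<close>. Each branch of \<open>density_f\<close>
  matches one term of the minimum.\<close>

lemma density_f_le_upper_density_sumset: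
  fixes B :: "nat set"
  assumes "0 \<in> B" "Gcd B = 1"
  shows "density_f (upper_density B) \<le> upper_density (B + B)"
proof (cases "upper_density B = 0")
  case True
  then show ?thesis using upper_density_nonneg by (simp add: density_f_def)
next
  case False
  define d where "d = upper_density B"
  have d: "0 < d" using False upper_density_nonneg[of B] by (simp add: d_def)
  obtain n0 where n0: "\<And>n. n0 \<le> n \<Longrightarrow> Gcd (B \<inter> {..n}) = 1"
    using Gcd_Int_atMost_eq_1[OF assms(2)] by blast
  show ?thesis
  proof (rule upper_density_geI)
    fix e :: real assume e: "0 < e"
    define e1 where "e1 = min (e / 2) (d / 2)"
    have e1: "0 < e1" "e1 \<le> e / 2" "e1 \<le> d / 2" using e d by (auto simp: e1_def)
    have "d - e1 < upper_density B" using e1 by (simp add: d_def)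
    then have fr: "\<exists>\<^sub>F n in sequentially. (d - e1) * real n \<le> real (count_upto B n)"
      by (rule upper_density_greater_frequently)
    show "\<exists>\<^sub>F n in sequentially. (density_f (upper_density B) - e) * real n \<le> real (count_upto (B + B) n)"
      unfolding frequently_sequentially
    proof
      fix N
      \<comment> \<open>\<open>K\<close> collects what \<open>a\<close> must exceed:
        \<open>N\<close>, the threshold \<open>n0\<close> for gcd 1, and \<open>2 / e\<close> to
        absorb the constants. It is enforced through the count, since only
        \<open>count_upto B y \<le> a\<close> bounds \<open>a\<close> from below.\<close>
      define K where "K = real N + real n0 + 2 / e + 1"
      obtain y where y: "y \<ge> nat \<lceil>2 * K / d\<rceil>" "(d - e1) * real y \<le> real (count_upto B y)"
        using fr unfolding frequently_sequentially by blast
      have "2 * K / d \<le> real y" using y by linarith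
      then have "K \<le> d / 2 * real y" using d by (simp add: field_simps)
      also have "\<dots> \<le> (d - e1) * real y" using e1 by (intro mult_right_mono) auto
      finally have cK: "K \<le> real (count_upto B y)" using y(2) by linarith
      moreover have "0 < K" using e by (auto simp: K_def intro!: add_nonneg_pos)
      ultimately have "B \<inter> {1..y} \<noteq> {}" by (metis card.empty of_nat_0 not_less)
      \<comment> \<open>Going back from \<open>y\<close> to the last element keeps the count, does
        not lower the ratio, and gives a segment whose maximum is its length.\<close>
      define a where "a = Max (B \<inter> {1..y})"
      have a: "a \<in> B" "1 \<le> a" "a \<le> y" "\<And>b. b \<in> B \<Longrightarrow> b \<le> y \<Longrightarrow> b \<le> a"
      proof -
        have "a \<in> B \<inter> {1..y}" unfolding a_def using \<open>B \<inter> {1..y} \<noteq> {}\<close> by (intro Max_in) auto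
        then show "a \<in> B" "1 \<le> a" "a \<le> y" by auto
        then show "b \<le> a" if "b \<in> B" "b \<le> y" for b
          using that unfolding a_def by (cases "b = 0") (auto intro!: Max_ge)
      qed
      define C where "C = B \<inter> {..a}"
      define c where "c = count_upto B y"
      have CC: "C = insert 0 (B \<inter> {1..y})"
        using a assms by (auto simp: C_def)
      then have cC: "card C = c + 1" by (simp add: c_def)
      have "B \<inter> {1..y} = B \<inter> {1..a}" using a by force
      then have "c \<le> a" using count_upto_le[of B a] by (simp add: c_def)
      then have Ka: "K \<le> real a" using cK by (simp add: c_def)
      then have "n0 \<le> a" "N \<le> a" "2 / e \<le> real a" using e unfolding K_def
        by (smt (verit) divide_nonneg_pos of_nat_0_le_iff of_nat_le_iff)+
      have "Gcd C = 1" using n0[OF \<open>n0 \<le> a\<close>] by (simp add: C_def)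
      moreover have "Max C = a" using a by (intro Max_eqI) (auto simp: C_def)
      ultimately have F: "min (3 * c) (c + 1 + a) \<le> card (C + C)"
        using card_sumset_Freiman[of C] assms cC by (simp add: C_def)
      have "C + C - {0} \<subseteq> (B + B) \<inter> {1..2 * a}"
      proof
        fix n assume n: "n \<in> C + C - {0}"
        then obtain x y where "x \<in> C" "y \<in> C" "n = x + y" by (blast elim: set_plus_elim)
        then have "x + y \<in> B + B" "n \<le> 2 * a" "n = x + y"
          by (auto simp: C_def intro: set_plus_intro)
        then show "n \<in> (B + B) \<inter> {1..2 * a}" using n by auto
      qed
      then have "card (C + C - {0}) \<le> count_upto (B + B) (2 * a)" by (intro card_mono) auto
      moreover have "card (C + C) - 1 \<le> card (C + C - {0})"
        by (simp add: card_Diff_singleton_if)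
      ultimately have le: "min (3 * real c) (real c + real a) - 1 \<le> real (count_upto (B + B) (2 * a))"
        using F by linarith
      have "(d - e1) * real a \<le> (d - e1) * real y" using a e1 d by (intro mult_left_mono) auto
      then have ca: "(d - e1) * real a \<le> real c" using y(2) by (simp add: c_def)
      have ea: "2 \<le> e * real a" using \<open>2 / e \<le> real a\<close> e by (simp add: field_simps)
      have e1a: "e1 * real a \<le> e * real a / 2" using mult_right_mono[OF e1(2), of "real a"] by simp
      have "(density_f d - e) * real (2 * a) \<le> 3 * real c - 1"
      proof -
        have "(density_f d - e) * real (2 * a) \<le> (3 * d / 2 - e) * real (2 * a)"
          by (intro mult_right_mono) (auto simp: density_f_def)
        then show ?thesis using ca ea e1a by (simp add: algebra_simps)
      qed
      moreover have "(density_f d - e) * real (2 * a) \<le> real c + real a - 1"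
      proof -
        have "(density_f d - e) * real (2 * a) \<le> ((1 + d) / 2 - e) * real (2 * a)"
          unfolding density_f_def by (intro mult_right_mono diff_right_mono min.cobounded2) simp
        also have "\<dots> = real a + d * real a - 2 * (e * real a)" by (simp add: algebra_simps)
        finally show ?thesis using ca ea e1a by (simp add: algebra_simps)
      qed
      ultimately have "(density_f d - e) * real (2 * a) \<le> real (count_upto (B + B) (2 * a))"
        using le by linarith
      moreover have "N \<le> 2 * a" using \<open>N \<le> a\<close> by simp
      ultimately show "\<exists>n\<ge>N. (density_f (upper_density B) - e) * real n \<le> real (count_upto (B + B) n)"
        unfolding d_def by blast
    qed
  qed
qed

text \<open>\<open>c\<close> is the least element and \<open>g\<close> the gcd of the differences
  from it, which is positive because some difference is nonzero.\<close>

lemma affine_normal_form: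
  fixes A :: "nat set"
  assumes "infinite A"
  obtains c g B where "0 < g" "0 \<in> B" "Gcd B = 1" "A = (\<lambda>b. c + g * b) ` B"
proof -
  define c where "c = (LEAST x. x \<in> A)"
  have "A \<noteq> {}" using assms by auto
  then have c: "c \<in> A" "\<And>x. x \<in> A \<Longrightarrow> c \<le> x"
    unfolding c_def by (auto intro: LeastI Least_le)
  define D where "D = (\<lambda>x. x - c) ` A"
  define g where "g = Gcd D"
  have "\<not> A \<subseteq> {c}" using assms finite_subset by blast
  then obtain x where x: "x \<in> A" "x \<noteq> c" by auto
  then have "x - c \<in> D" "x - c \<noteq> 0" using c(2)[of x] by (auto simp: D_def)
  then have g: "0 < g" unfolding g_def by (metis Gcd_0_iff gr0I singletonD subsetD)
  define B where "B = {b. c + g * b \<in> A}"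
  have A: "A = (\<lambda>b. c + g * b) ` B"
  proof (intro equalityI subsetI)
    fix x assume x: "x \<in> A"
    then have "g dvd x - c" unfolding g_def D_def by (intro Gcd_dvd) auto
    then obtain b where "x - c = g * b" by (elim dvdE)
    then have "x = c + g * b" using c(2)[OF x] by simp
    then show "x \<in> (\<lambda>b. c + g * b) ` B" using x by (auto simp: B_def)
  qed (auto simp: B_def)
  have "g * Gcd B dvd g"
  proof -
    have "g * Gcd B dvd y" if "y \<in> D" for y
    proof -
      obtain b where "b \<in> B" "y = g * b" using \<open>y \<in> D\<close> by (auto simp: D_def A)
      then show ?thesis by (simp add: mult_dvd_mono)
    qed
    then have "g * Gcd B dvd Gcd D" by (rule Gcd_greatest)
    then show ?thesis by (simp add: g_def)
  qed
  then have "Gcd B = 1" using g by (metis dvd_mult_cancel1)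
  moreover have "0 \<in> B" using c by (simp add: B_def)
  ultimately show ?thesis using that g A by blast
qed

lemma upper_density_finite:
  assumes "finite A"
  shows "upper_density A = 0"
proof (rule antisym[OF upper_density_leI upper_density_nonneg])
  fix e :: real assume e: "0 < e"
  have "\<forall>\<^sub>F n in sequentially. real (card A) / e \<le> real n"
    using filterlim_real_sequentially unfolding filterlim_at_top by blast
  then show "\<forall>\<^sub>F n in sequentially. real (count_upto A n) \<le> (0 + e) * real n"
  proof eventually_elim
    case (elim n)
    have "count_upto A n \<le> card A" using assms by (intro card_mono) auto
    then show ?case using elim e by (simp add: field_simps)
  qed
qed

text \<open>The witness \<open>k\<close> is the \<open>g\<close> of the normal form:
  \<open>A + A\<close> is \<open>B + B\<close> scaled by the same \<open>g\<close>, with shift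
  \<open>2 * c\<close>. Finite sets give the pair (0, 0).\<close>

lemma upper_densities_sumset_mem:
  fixes A :: "nat set"
  shows "\<exists>\<alpha>1 \<alpha>2 k. (upper_density A, upper_density (A + A)) = (1 / real k * \<alpha>1, 1 / real k * \<alpha>2) \<and>
           (\<alpha>1, \<alpha>2) \<in> region_U \<and> k \<ge> 1"
proof (cases "finite A")
  case True
  then have "upper_density A = 0" "upper_density (A + A) = 0"
    by (auto intro!: upper_density_finite finite_set_plus)
  then show ?thesis
    by (intro exI[of _ 0] exI[of _ 1]) (auto simp: region_U_def density_f_def)
next
  case False
  then obtain c g B where B: "0 < g" "0 \<in> B" "Gcd B = 1" "A = (\<lambda>b. c + g * b) ` B"
    by (rule affine_normal_form)
  have "(upper_density B, upper_density (B + B)) \<in> region_U"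
    using density_f_le_upper_density_sumset[OF B(2,3)] upper_density_nonneg upper_density_le_1
    by (simp add: region_U_def)
  moreover have "upper_density A = 1 / real g * upper_density B"
    "upper_density (A + A) = 1 / real g * upper_density (B + B)"
    using B(1) by (simp_all add: B(4) sumset_affine_image upper_density_affine_image)
  ultimately show ?thesis using B(1) by (metis Suc_leI One_nat_def)
qed

section \<open>Prescribed upper densities\<close>

lemma eventually_le_mult_real:
  assumes "0 < c"
  shows "\<forall>\<^sub>F n in sequentially. d \<le> c * real n"
proof -
  have "\<forall>\<^sub>F n in sequentially. d / c \<le> real n"
    using filterlim_real_sequentially unfolding filterlim_at_top by blast
  then show ?thesis by (rule eventually_mono) (use assms in \<open>simp add: field_simps\<close>)
qed

lemma count_upto_Un: "count_upto (A \<union> B) x \<le> count_upto A x + count_upto B x"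
  by (metis Int_Un_distrib2 card_Un_le)

lemma count_upto_mono: "A \<subseteq> B \<Longrightarrow> count_upto A x \<le> count_upto B x"
  by (intro card_mono) auto

lemma count_upto_le_card: "finite A \<Longrightarrow> count_upto A x \<le> card A"
  by (intro card_mono) auto

lemma count_upto_greaterThanAtMost: "count_upto {a<..b} x = min b x - a"
proof -
  have "{a<..b} \<inter> {1..x} = {a<..min b x}" by auto
  then show ?thesis by simp
qed

lemma count_upto_eq_0: "(\<And>a. a \<in> A \<Longrightarrow> x < a) \<Longrightarrow> count_upto A x = 0"
proof -
  assume "\<And>a. a \<in> A \<Longrightarrow> x < a"
  then have "A \<inter> {1..x} = {}" by force
  then show ?thesis by simp
qed

section \<open>From stages to their union\<close>

text \<open>Summands never exceed their sum, so later stages cannot change the sumset below the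
  current cutoff.\<close>

lemma sumset_Int_eq:
  fixes A :: "nat set"
  assumes "A \<inter> {..t} = P" "x \<le> t"
  shows "(A + A) \<inter> {1..x} = (P + P) \<inter> {1..x}"
proof (intro equalityI subsetI)
  fix n assume n: "n \<in> (A + A) \<inter> {1..x}"
  then obtain a b where "a \<in> A" "b \<in> A" "n = a + b" by (blast elim: set_plus_elim)
  moreover from this have "a \<in> P" "b \<in> P" using n assms by auto
  ultimately show "n \<in> (P + P) \<inter> {1..x}" using n by (auto intro: set_plus_intro)
next
  fix n assume n: "n \<in> (P + P) \<inter> {1..x}"
  then obtain a b where "a \<in> P" "b \<in> P" "n = a + b" by (blast elim: set_plus_elim)
  then show "n \<in> (A + A) \<inter> {1..x}" using n assms by (auto intro: set_plus_intro)
qed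

lemma chain_Int_atMost:
  fixes P :: "nat \<Rightarrow> nat set"
  assumes mono: "strict_mono t" and sub: "\<And>n. P n \<subseteq> {..t n}"
    and ext: "\<And>n. P (Suc n) \<inter> {..t n} = P n"
  shows "(\<Union>n. P n) \<inter> {..t n} = P n"
proof -
  have inc: "P m \<subseteq> P k" if "m \<le> k" for m k
    using that by (induction k rule: dec_induct) (use ext in blast)+
  have "P k \<inter> {..t n} \<subseteq> P n" if "n \<le> k" for k
    using that
  proof (induction k rule: dec_induct)
    case (step k)
    have "t n \<le> t k" using mono step(1) by (simp add: strict_mono_less_eq)
    then have "P (Suc k) \<inter> {..t n} \<subseteq> P (Suc k) \<inter> {..t k} \<inter> {..t n}" by auto
    then show ?case using ext[of k] step by blast
  qed simp
  then have "P k \<inter> {..t n} \<subseteq> P n" for k using inc[of k n] by (cases "n \<le> k") auto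
  then show ?thesis using sub[of n] by blast
qed

text \<open>Each large \<open>x\<close> lies in a window between consecutive cutoffs, the one ending
  at the least \<open>t k \<ge> x\<close>; so estimates may be proved window by window.\<close>

lemma eventually_chain:
  assumes mono: "strict_mono (t :: nat \<Rightarrow> nat)"
    and ev: "\<forall>\<^sub>F n in sequentially. \<forall>x. t n < x \<longrightarrow> x \<le> t (Suc n) \<longrightarrow> R x"
  shows "\<forall>\<^sub>F x in sequentially. R x"
proof -
  obtain m where m: "\<And>n x. m \<le> n \<Longrightarrow> t n < x \<Longrightarrow> x \<le> t (Suc n) \<Longrightarrow> R x"
    using ev by (auto simp: eventually_sequentially)
  have "R x" if x: "t m < x" for x
  proof -
    define k where "k = (LEAST k. x \<le> t k)"
    have "x \<le> t x" using mono by (rule strict_mono_imp_increasing)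
    then have k: "x \<le> t k" unfolding k_def by (rule LeastI)
    have "m < k" using x k mono by (metis leD le_less_trans not_less strict_mono_less_eq)
    then have "\<not> x \<le> t (k - 1)" unfolding k_def by (intro not_less_Least) simp
    then show ?thesis using m[of "k - 1" x] k \<open>m < k\<close> by simp
  qed
  then show ?thesis unfolding eventually_sequentially by (intro exI[of _ "Suc (t m)"]) auto
qed

lemma frequently_chain:
  assumes mono: "strict_mono (t :: nat \<Rightarrow> nat)"
    and fr: "\<exists>\<^sub>F n in sequentially. \<exists>x \<ge> t n. R x"
  shows "\<exists>\<^sub>F x in sequentially. R x"
  unfolding frequently_sequentially
proof
  fix N
  obtain n x where "n \<ge> N" "t n \<le> x" "R x" using fr unfolding frequently_sequentially by blast
  moreover have "n \<le> t n" using mono by (rule strict_mono_imp_increasing)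
  ultimately show "\<exists>x\<ge>N. R x" by (intro exI[of _ x]) auto
qed

section \<open>Interval stages and thin stages\<close>

text \<open>The ratio rises along the interval and falls behind it, so the worst \<open>x\<close> is
  \<open>M\<close>, with ratio \<open>K / M\<close>.\<close>

lemma count_upto_interval_le:
  assumes \<alpha>: "0 \<le> \<alpha>" "\<alpha> \<le> 1" and K: "real K \<le> \<alpha> * real M" "K \<le> M"
  shows "real (count_upto {M - K<..M} x) \<le> \<alpha> * real x"
proof -
  consider "x \<le> M - K" | "M - K \<le> x" "x \<le> M" | "M \<le> x" by linarith
  then show ?thesis
  proof cases
    case 1
    then have "count_upto {M - K<..M} x = 0" unfolding count_upto_greaterThanAtMost by simp
    then show ?thesis using \<alpha> by (simp only:) simp
  next
    case 2
    have "(1 - \<alpha>) * real x \<le> (1 - \<alpha>) * real M" using 2 \<alpha> by (intro mult_left_mono) auto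
    moreover have "real (count_upto {M - K<..M} x) = real x - real M + real K"
      unfolding count_upto_greaterThanAtMost using 2 K by (simp add: of_nat_diff)
    ultimately show ?thesis using K by (simp add: algebra_simps)
  next
    case 3
    have "\<alpha> * real M \<le> \<alpha> * real x" using 3 \<alpha> by (intro mult_left_mono) auto
    moreover have "count_upto {M - K<..M} x = K"
      using 3 K unfolding count_upto_greaterThanAtMost by simp
    ultimately show ?thesis using K by simp
  qed
qed

text \<open>The first interval is there because old small elements plus the block nearly reproduce
  the block. The worst \<open>x\<close> is \<open>2 * M\<close>: there are at most
  \<open>3 * K\<close> elements, and at most \<open>M + K\<close> since all lie above
  \<open>M - K\<close>. These are the two branches of \<open>density_f\<close>.\<close>

lemma count_upto_interval_sumset_le:
  assumes \<alpha>: "0 \<le> \<alpha>" "\<alpha> \<le> 1" and K: "real K \<le> \<alpha> * real M" "K \<le> M"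
  shows "real (count_upto ({M - K<..M} \<union> {2 * (M - K)<..2 * M}) x) \<le> density_f \<alpha> * real x"
proof -
  define c where "c = count_upto ({M - K<..M} \<union> {2 * (M - K)<..2 * M}) x"
  have "real c \<le> density_f \<alpha> * real x"
  proof (cases "\<alpha> \<le> 1 / 2")
    case True
    have f: "density_f \<alpha> = 3 * \<alpha> / 2" using True by (simp add: density_f_def min_def)
    have "c \<le> count_upto {M - K<..M} x + count_upto {2 * (M - K)<..2 * M} x"
      unfolding c_def by (rule count_upto_Un)
    then have le: "c \<le>
      (min M x - (M - K)) + (min (2 * M) x - 2 * (M - K))"
      by (simp only: count_upto_greaterThanAtMost)
    consider "x \<le> 2 * (M - K)" | "2 * (M - K) \<le> x" "x \<le> 2 * M" | "2 * M \<le> x" by linarith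
    then show ?thesis
    proof cases
      case 1
      then have "c \<le> count_upto {M - K<..M} x"
        using le unfolding count_upto_greaterThanAtMost by simp
      then have "real c \<le> \<alpha> * real x"
        using count_upto_interval_le[OF assms, of x] by linarith
      also have "\<dots> \<le> density_f \<alpha> * real x"
        unfolding f using \<alpha> by (intro mult_right_mono) auto
      finally show ?thesis .
    next
      case 2
      have "c + 2 * M \<le> 3 * K + x"
        using le 2 K by (auto simp: min_def split: if_splits)
      then have "real c + 2 * real M \<le> 3 * real K + real x"
        by linarith
      \<comment> \<open>\<open>z\<close> is the drop of the bound from \<open>2 * M\<close> back to
        \<open>x\<close>. Its slope is below 1, the slope of the count there, so
        \<open>2 * M\<close> is decisive.\<close>
      moreover define z where "z = 3 * \<alpha> / 2 * (2 * real M - real x)"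
      have "z \<le> 2 * real M - real x"
        unfolding z_def using 2 True \<alpha> by (intro mult_left_le_one_le) auto
      ultimately have "real c \<le> 3 * (\<alpha> * real M) - z"
        using K by linarith
      also have "\<dots> = density_f \<alpha> * real x" unfolding f z_def by (simp add: field_simps)
      finally show ?thesis .
    next
      case 3
      then have "c \<le> 3 * K" using le K by simp
      then have "real c \<le> 3 * (\<alpha> * real M)"
        using K by linarith
      also have "\<dots> = 3 * \<alpha> / 2 * (2 * real M)" by simp
      also have "\<dots> \<le> 3 * \<alpha> / 2 * real x" using 3 \<alpha> by (intro mult_left_mono) auto
      finally show ?thesis unfolding f .
    qed
  next
    case False
    have f: "density_f \<alpha> = (1 + \<alpha>) / 2" using False by (simp add: density_f_def min_def)
    have "c \<le> count_upto {M - K<..2 * M} x"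
      unfolding c_def by (rule count_upto_mono) auto
    then have le: "c \<le> min (2 * M) x - (M - K)"
      by (simp only: count_upto_greaterThanAtMost)
    consider "x \<le> M - K" | "M - K \<le> x" "x \<le> 2 * M" | "2 * M \<le> x" by linarith
    then show ?thesis
    proof cases
      case 1
      then show ?thesis using le \<alpha> by (simp add: f)
    next
      case 2
      have "c + M \<le> x + K" using le 2 K by simp
      then have "real c + real M \<le> real x + real K"
        by linarith
      moreover have "(1 - \<alpha>) / 2 * real x \<le> (1 - \<alpha>) / 2 * (2 * real M)"
        using 2 \<alpha> by (intro mult_left_mono) auto
      moreover have "(1 - \<alpha>) / 2 * (2 * real M) = real M - \<alpha> * real M" by (simp add: field_simps)
      ultimately have "real c \<le> real x - (1 - \<alpha>) / 2 * real x"
        using K by linarith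
      also have "\<dots> = density_f \<alpha> * real x" unfolding f by (simp add: field_simps)
      finally show ?thesis .
    next
      case 3
      then have "c \<le> M + K" using le K by simp
      then have "real c \<le> real M + real K" by linarith
      also have "\<dots> \<le> real M + \<alpha> * real M" using K by simp
      also have "\<dots> = (1 + \<alpha>) / 2 * (2 * real M)" by (simp add: field_simps)
      also have "\<dots> \<le> (1 + \<alpha>) / 2 * real x" using 3 \<alpha> by (intro mult_left_mono) auto
      finally show ?thesis unfolding f .
    qed
  qed
  then show ?thesis unfolding c_def .
qed

lemma floor_mult_bounds:
  assumes "0 \<le> \<alpha>" "\<alpha> \<le> 1"
  shows "real (nat \<lfloor>\<alpha> * real M\<rfloor>) \<le> \<alpha> * real M" "\<alpha> * real M - 1 \<le> real (nat \<lfloor>\<alpha> * real M\<rfloor>)"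
    "nat \<lfloor>\<alpha> * real M\<rfloor> \<le> M"
proof -
  have nn: "0 \<le> \<alpha> * real M" using assms by simp
  then show 1: "real (nat \<lfloor>\<alpha> * real M\<rfloor>) \<le> \<alpha> * real M" by (rule of_nat_floor)
  show "\<alpha> * real M - 1 \<le> real (nat \<lfloor>\<alpha> * real M\<rfloor>)" using nn by linarith
  have "\<alpha> * real M \<le> 1 * real M" using assms by (intro mult_right_mono) auto
  then show "nat \<lfloor>\<alpha> * real M\<rfloor> \<le> M" using 1 by linarith
qed

text \<open>\<open>P\<close> and \<open>P + P\<close> weigh at most e/4 each at every
  \<open>x > t\<close>, and mixed sums leave the block only by \<open>{M<..M + t}\<close>, another
  e/4.\<close>

lemma interval_step:
  assumes \<alpha>: "0 \<le> \<alpha>" "\<alpha> \<le> 1" "density_f \<alpha> \<le> \<beta>" and e: "0 < e"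
    and P: "finite P" "P \<subseteq> {..t}" "real (card P) \<le> e / 4 * real t" "real (card (P + P)) \<le> e / 4 * real t"
  shows "\<exists>Q. finite Q \<and> Q \<inter> {..t} = P \<and>
    (\<forall>x>t. real (count_upto Q x) \<le> (\<alpha> + e) * real x \<and> real (count_upto (Q + Q) x) \<le> (\<beta> + e) * real x) \<and>
    (\<exists>x>t. (\<alpha> - e) * real x \<le> real (count_upto Q x))"
proof -
  have "\<forall>\<^sub>F M in sequentially. t < M \<and> real t \<le> e / 4 * real M \<and> real t + 1 \<le> e * real M"
    using e by (intro eventually_conj eventually_gt_at_top eventually_le_mult_real) auto
  then obtain M where M: "t < M" "real t \<le> e / 4 * real M" "real t + 1 \<le> e * real M"
    by (auto simp: eventually_sequentially)
  define K where "K = nat \<lfloor>\<alpha> * real M\<rfloor>"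
  note K = floor_mult_bounds[OF \<alpha>(1,2), of M, folded K_def]
  \<comment> \<open>Starting \<open>t\<close> later keeps \<open>X\<close> off \<open>{..t}\<close>
    even for \<alpha> = 1; the \<open>t\<close> lost elements are covered by
    \<open>e * M\<close>.\<close>
  define X where "X = {M - K + t<..M}"
  define Q where "Q = P \<union> X"
  have fin: "finite Q" using P by (simp add: Q_def X_def)
  have sub: "Q + Q \<subseteq> (P + P) \<union> ({M - K<..M} \<union> {2 * (M - K)<..2 * M}) \<union> {M<..M + t}"
  proof
    fix n assume "n \<in> Q + Q"
    then obtain a b where ab: "a \<in> Q" "b \<in> Q" "n = a + b" by (blast elim: set_plus_elim)
    have t: "c \<le> t" if "c \<in> P" for c using that P by auto
    show "n \<in> (P + P) \<union> ({M - K<..M} \<union> {2 * (M - K)<..2 * M}) \<union> {M<..M + t}"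
    proof (cases "a \<in> P \<and> b \<in> P")
      case True
      then show ?thesis using ab by (auto intro: set_plus_intro)
    next
      case False
      then show ?thesis using ab t[of a] t[of b] by (auto simp: Q_def X_def)
    qed
  qed
  have bound: "real (count_upto Q x) \<le> (\<alpha> + e) * real x \<and> real (count_upto (Q + Q) x) \<le> (\<beta> + e) * real x"
    if x: "t < x" for x
  proof
    have tx: "e / 4 * real t \<le> e / 4 * real x" using x e by (intro mult_left_mono) auto
    have "count_upto Q x \<le> count_upto P x + count_upto X x" unfolding Q_def by (rule count_upto_Un)
    also have "\<dots> \<le> card P + count_upto {M - K<..M} x"
      using P by (intro add_mono count_upto_le_card count_upto_mono) (auto simp: X_def)
    finally have "real (count_upto Q x) \<le> real (card P) + real (count_upto {M - K<..M} x)" by linarith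
    also have "\<dots> \<le> e / 4 * real x + \<alpha> * real x"
      using P tx count_upto_interval_le[OF \<alpha>(1,2) K(1,3), of x] by linarith
    also have "\<dots> \<le> (\<alpha> + e) * real x" using e by (simp add: algebra_simps)
    finally show "real (count_upto Q x) \<le> (\<alpha> + e) * real x" .
    have M': "real (count_upto {M<..M + t} x) \<le> e / 4 * real x"
    proof (cases "x \<le> M")
      case True
      then show ?thesis using e unfolding count_upto_greaterThanAtMost by simp
    next
      case False
      then have "e / 4 * real M \<le> e / 4 * real x" using e by (intro mult_left_mono) auto
      moreover have "count_upto {M<..M + t} x \<le> t" unfolding count_upto_greaterThanAtMost by simp
      ultimately show ?thesis using M by linarith
    qed
    have "count_upto (Q + Q) x \<le> count_upto ((P + P) \<union> ({M - K<..M} \<union> {2 * (M - K)<..2 * M}) \<union> {M<..M + t}) x"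
      using sub by (rule count_upto_mono)
    also have "\<dots> \<le> count_upto (P + P) x + count_upto ({M - K<..M} \<union> {2 * (M - K)<..2 * M}) x + count_upto {M<..M + t} x"
      by (meson add_mono count_upto_Un order_refl order_trans)
    also have "count_upto (P + P) x \<le> card (P + P)" using P by (intro count_upto_le_card finite_set_plus)
    finally have "real (count_upto (Q + Q) x) \<le> e / 4 * real t + real (count_upto ({M - K<..M} \<union> {2 * (M - K)<..2 * M}) x) + e / 4 * real x"
      using P M' by linarith
    also have "real (count_upto ({M - K<..M} \<union> {2 * (M - K)<..2 * M}) x) \<le> density_f \<alpha> * real x"
      using \<alpha>(1,2) K(1,3) by (rule count_upto_interval_sumset_le)
    also have "density_f \<alpha> * real x \<le> \<beta> * real x" using \<alpha> by (intro mult_right_mono) auto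
    also have "e / 4 * real t + \<beta> * real x + e / 4 * real x \<le> (\<beta> + e) * real x"
    proof -
      have "0 \<le> e * real x" using e by simp
      then show ?thesis using tx by (simp add: algebra_simps)
    qed
    finally show "real (count_upto (Q + Q) x) \<le> (\<beta> + e) * real x" by simp
  qed
  have "count_upto X M \<le> count_upto Q M" by (rule count_upto_mono) (simp add: Q_def)
  then have "M - (M - K + t) \<le> count_upto Q M"
    unfolding X_def count_upto_greaterThanAtMost by simp
  then have "real K - real t \<le> real (count_upto Q M)" using K(3) by linarith
  then have "(\<alpha> - e) * real M \<le> real (count_upto Q M)" using K(2) M(3) by (simp add: algebra_simps)
  moreover have "Q \<inter> {..t} = P" using P by (auto simp: Q_def X_def)
  ultimately show ?thesis using fin bound M(1) by blast
qed

text \<open>Writing m < q * q in base \<open>q\<close> shows that the shifted low digits and shifted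
  high digits together, at most \<open>2 * q\<close> elements, have all of
  \<open>{2 * N..<2 * N + q * q}\<close> as sums. All other new sums number O(q) for fixed
  \<open>P\<close>, negligible against \<open>N\<close>.\<close>

lemma thin_step:
  assumes \<beta>: "0 < \<beta>" "\<beta> \<le> 1" and \<alpha>: "0 \<le> \<alpha>" and e: "0 < e"
    and P: "finite P" "P \<subseteq> {..t}" "real (card P) \<le> e / 4 * real t" "real (card (P + P)) \<le> e / 4 * real t"
  shows "\<exists>Q. finite Q \<and> Q \<inter> {..t} = P \<and>
    (\<forall>x>t. real (count_upto Q x) \<le> (\<alpha> + e) * real x \<and> real (count_upto (Q + Q) x) \<le> (\<beta> + e) * real x) \<and>
    (\<exists>x>t. (\<beta> - e) * real x \<le> real (count_upto (Q + Q) x))"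
proof -
  define \<delta> where "\<delta> = e / 4"
  \<comment> \<open>For N = \<gamma> * q * q the interval has density 1 / (2 \<gamma> + 1) at its
    right end, which is \<beta> for \<gamma> = (1 - \<beta>) / (2 \<beta>). The extra \<delta> keeps
    \<open>N\<close> of order q * q also for \<beta> = 1, where this value is 0.\<close>
  define \<gamma> where "\<gamma> = (1 - \<beta>) / (2 * \<beta>) + \<delta>"
  have \<delta>: "0 < \<delta>" using e by (simp add: \<delta>_def)
  have \<gamma>: "\<delta> \<le> \<gamma>" using \<beta> by (simp add: \<gamma>_def)
  have \<beta>\<gamma>: "2 * \<beta> * \<gamma> = 1 - \<beta> + 2 * \<beta> * \<delta>" using \<beta> by (simp add: \<gamma>_def field_simps)
  define p where "p = real (card P)"
  have "\<forall>\<^sub>F q in sequentially. 2 \<le> q \<and> real t + 1 \<le> \<delta> * real q \<and> 2 * p + 3 \<le> (3 / 4 * e * \<delta>) * real q \<and> 4 \<le> e * real q"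
    using e \<delta> by (intro eventually_conj eventually_ge_at_top eventually_le_mult_real) auto
  then obtain q where q: "2 \<le> q" "real t + 1 \<le> \<delta> * real q" "2 * p + 3 \<le> (3 / 4 * e * \<delta>) * real q" "4 \<le> e * real q"
    by (auto simp: eventually_sequentially)
  define s where "s = real q * real q"
  have qs: "real q \<le> s" using q(1) unfolding s_def by (metis mult_left_mono mult.right_neutral of_nat_0_le_iff of_nat_1 of_nat_le_iff one_le_numeral order_trans)
  define N where "N = nat \<lceil>\<gamma> * s\<rceil>"
  have "0 \<le> \<gamma> * s" using \<gamma> \<delta> by (simp add: s_def)
  then have N: "\<gamma> * s \<le> real N" "real N \<le> \<gamma> * s + 1" unfolding N_def by linarith+
  have N\<delta>: "\<delta> * s \<le> real N" using N(1) mult_right_mono[OF \<gamma>, of s] by (simp add: s_def)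
  have "\<delta> * real q \<le> \<delta> * s" using qs \<delta> by simp
  then have Nt: "t < N" using N\<delta> q(2) by linarith
  \<comment> \<open>\<open>2 * q * p\<close> bounds the mixed sums; \<open>3 * q\<close> covers the
    at most \<open>2 * q\<close> sums of \<open>X + X\<close> outside \<open>I\<close> and the + 1
    of \<open>cI\<close>.\<close>
  have Np: "2 * real q * p + 3 * real q \<le> 3 / 4 * e * real N"
  proof -
    have "(2 * p + 3) * real q \<le> ((3 / 4 * e * \<delta>) * real q) * real q"
      using q(3) by (intro mult_right_mono) auto
    also have "\<dots> = 3 / 4 * e * (\<delta> * s)" by (simp add: s_def)
    also have "\<dots> \<le> 3 / 4 * e * real N" using N\<delta> e by (intro mult_left_mono) auto
    finally show ?thesis by (simp add: algebra_simps)
  qed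
  define X where "X = (\<lambda>i. N + i) ` {..<q} \<union> (\<lambda>j. N + j * q) ` {..<q}"
  define I where "I = {2 * N..<2 * N + q * q}"
  define Q where "Q = P \<union> X"
  have finX: "finite X" by (simp add: X_def)
  have fin: "finite Q" using P finX by (simp add: Q_def)
  have cX: "card X \<le> 2 * q"
  proof -
    have "card X \<le> card ((\<lambda>i. N + i) ` {..<q}) + card ((\<lambda>j. N + j * q) ` {..<q})"
      unfolding X_def by (rule card_Un_le)
    also have "\<dots> \<le> q + q"
      using card_image_le[of "{..<q}" "\<lambda>i. N + i"] card_image_le[of "{..<q}" "\<lambda>j. N + j * q"] by simp
    finally show ?thesis by simp
  qed
  have XN: "N \<le> a" if "a \<in> X" for a using that by (auto simp: X_def)
  have lt: "i + j * q < q * q" if "i < q" "j < q" for i j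
  proof -
    have "Suc j * q \<le> q * q" using that by (intro mult_le_mono1) simp
    then show ?thesis using that by simp
  qed
  have XX: "X + X \<subseteq> I \<union> (\<lambda>j. 2 * N + j * q) ` {..<2 * q}"
  proof
    fix n assume "n \<in> X + X"
    then obtain a b where ab: "a \<in> X" "b \<in> X" "n = a + b" by (blast elim: set_plus_elim)
    have mixed: "c + d \<in> I" if "c \<in> (\<lambda>i. N + i) ` {..<q}" "d \<in> (\<lambda>j. N + j * q) ` {..<q}" for c d
      using that lt by (auto simp: I_def)
    consider "a \<in> (\<lambda>i. N + i) ` {..<q}" "b \<in> (\<lambda>i. N + i) ` {..<q}"
      | "a \<in> (\<lambda>i. N + i) ` {..<q}" "b \<in> (\<lambda>j. N + j * q) ` {..<q}"
      | "b \<in> (\<lambda>i. N + i) ` {..<q}" "a \<in> (\<lambda>j. N + j * q) ` {..<q}"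
      | "a \<in> (\<lambda>j. N + j * q) ` {..<q}" "b \<in> (\<lambda>j. N + j * q) ` {..<q}"
      using ab unfolding X_def by blast
    then show "n \<in> I \<union> (\<lambda>j. 2 * N + j * q) ` {..<2 * q}"
    proof cases
      case 1
      then obtain i j where ij: "i < q" "j < q" "a = N + i" "b = N + j" by auto
      have "2 * q \<le> q * q" using q(1) by (rule mult_le_mono1)
      then have "i + j < q * q" using ij by linarith
      then show ?thesis using ij ab by (auto simp: I_def)
    next
      case 2
      then show ?thesis using mixed[of a b] ab by simp
    next
      case 3
      then show ?thesis using mixed[of b a] ab by (simp add: add.commute)
    next
      case 4
      then obtain i j where ij: "i < q" "j < q" "a = N + i * q" "b = N + j * q" by auto
      then have "n = 2 * N + (i + j) * q" "i + j < 2 * q" using ab by (auto simp: algebra_simps)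
      then show ?thesis by blast
    qed
  qed
  have IXX: "I \<subseteq> X + X"
  proof
    fix n assume n: "n \<in> I"
    define m where "m = n - 2 * N"
    have m: "n = 2 * N + m" "m < q * q" using n by (auto simp: I_def m_def)
    have "m div q < q" "m mod q < q" using m q(1) by (auto simp: less_mult_imp_div_less)
    then have "(N + m mod q) + (N + m div q * q) \<in> X + X" by (intro set_plus_intro) (auto simp: X_def)
    moreover have "(N + m mod q) + (N + m div q * q) = n" using m by (simp add: mod_div_decomp)
    ultimately show "n \<in> X + X" by simp
  qed
  \<comment> \<open>The + 1 is due to \<open>I\<close> containing its left end. \<open>key\<close>
    says that \<beta> times the right end is at least the length of \<open>I\<close>.\<close>
  have cI: "real (count_upto I x) \<le> \<beta> * real x + 1" for x
  proof -
    have key: "(1 - \<beta>) * s \<le> 2 * \<beta> * real N"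
    proof -
      have "(1 - \<beta>) * s \<le> (2 * \<beta> * \<gamma>) * s"
        unfolding \<beta>\<gamma> using \<beta> \<delta> by (intro mult_right_mono) (auto simp: s_def)
      also have "\<dots> = 2 * \<beta> * (\<gamma> * s)" by simp
      also have "\<dots> \<le> 2 * \<beta> * real N" using N \<beta> by (intro mult_left_mono) auto
      finally show ?thesis .
    qed
    have "count_upto I x \<le> card {2 * N..<min (2 * N + q * q) (Suc x)}"
      by (intro card_mono) (auto simp: I_def)
    then have le: "count_upto I x \<le> min (2 * N + q * q) (Suc x) - 2 * N" by simp
    show ?thesis
    proof (cases "x < 2 * N + q * q")
      case True
      show ?thesis
      proof (cases "x < 2 * N")
        case True
        then have "count_upto I x = 0" using le by simp
        then show ?thesis using \<beta> by simp
      next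
        case False
        then have "real (count_upto I x) \<le> real x - 2 * real N + 1" using le by linarith
        moreover have "real x \<le> 2 * real N + s"
          using True unfolding s_def by (metis less_imp_le of_nat_add of_nat_le_iff of_nat_mult of_nat_numeral)
        then have "(1 - \<beta>) * real x \<le> (1 - \<beta>) * (2 * real N + s)" using \<beta> by (intro mult_left_mono) auto
        ultimately show ?thesis using key by (simp add: algebra_simps)
      qed
    next
      case False
      then have "real (count_upto I x) \<le> s" using le unfolding s_def
        by (metis add_diff_cancel_left' diff_le_mono min.cobounded1 of_nat_le_iff of_nat_mult order_trans)
      moreover have "2 * real N + s \<le> real x"
        using False unfolding s_def by (metis not_less of_nat_add of_nat_le_iff of_nat_mult of_nat_numeral)
      then have "\<beta> * (2 * real N + s) \<le> \<beta> * real x" using \<beta> by (intro mult_left_mono) auto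
      ultimately show ?thesis using key by (simp add: algebra_simps)
    qed
  qed
  have sub: "Q + Q \<subseteq> (P + P) \<union> (P + X) \<union> (X + X)"
  proof
    fix n assume "n \<in> Q + Q"
    then obtain a b where ab: "a \<in> Q" "b \<in> Q" "n = a + b" by (blast elim: set_plus_elim)
    then consider "a \<in> P" "b \<in> P" | "a \<in> P" "b \<in> X" | "b \<in> P" "a \<in> X" | "a \<in> X" "b \<in> X"
      unfolding Q_def by blast
    then show "n \<in> (P + P) \<union> (P + X) \<union> (X + X)"
      using ab by cases (auto intro: set_plus_intro simp: set_plus_intro[of b P a X, unfolded add.commute[of b a]])
  qed
  have cPX: "card (P + X) \<le> card P * (2 * q)"
  proof -
    have "P + X = (\<lambda>(a, b). a + b) ` (P \<times> X)" by (auto simp: set_plus_def)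
    then have "card (P + X) \<le> card (P \<times> X)"
      using card_image_le[of "P \<times> X" "\<lambda>(a, b). a + b"] P finX by simp
    also have "\<dots> \<le> card P * (2 * q)" using cX by (simp add: card_cartesian_product)
    finally show ?thesis .
  qed
  have bound: "real (count_upto Q x) \<le> (\<alpha> + e) * real x \<and> real (count_upto (Q + Q) x) \<le> (\<beta> + e) * real x"
    if x: "t < x" for x
  proof -
    have tx: "e / 4 * real t \<le> e / 4 * real x" using x e by (intro mult_left_mono) auto
    have 1: "count_upto Q x \<le> card P + count_upto X x"
      using count_upto_Un[of P X x] count_upto_le_card[OF P(1), of x] by (simp add: Q_def)
    have "count_upto (Q + Q) x \<le> count_upto ((P + P) \<union> (P + X) \<union> (X + X)) x"
      using sub by (rule count_upto_mono)
    also have "\<dots> \<le> count_upto (P + P) x + count_upto (P + X) x + count_upto (X + X) x"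
      by (meson add_mono count_upto_Un order_refl order_trans)
    also have "count_upto (P + P) x \<le> card (P + P)" using P by (intro count_upto_le_card finite_set_plus)
    finally have 2: "count_upto (Q + Q) x \<le> card (P + P) + count_upto (P + X) x + count_upto (X + X) x"
      by simp
    have ex: "0 \<le> e * real x" "0 \<le> \<alpha> * real x" "0 \<le> \<beta> * real x" using e \<alpha> \<beta> by auto
    show ?thesis
    proof (cases "x < N")
      case True
      then have X0: "count_upto X x = 0" using XN by (intro count_upto_eq_0) force
      have "count_upto (P + X) x = 0"
      proof (intro count_upto_eq_0)
        fix a assume "a \<in> P + X"
        then obtain b c where "c \<in> X" "a = b + c" by (blast elim: set_plus_elim)
        then show "x < a" using XN[of c] True by simp
      qed
      moreover have "count_upto (X + X) x = 0"
      proof (intro count_upto_eq_0)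
        fix a assume "a \<in> X + X"
        then obtain b c where "c \<in> X" "a = b + c" by (blast elim: set_plus_elim)
        then show "x < a" using XN[of c] True by simp
      qed
      ultimately have "real (count_upto (Q + Q) x) \<le> e / 4 * real x" using 2 P tx by linarith
      moreover have "real (count_upto Q x) \<le> e / 4 * real x" using 1 X0 P tx by linarith
      ultimately show ?thesis using ex by (simp add: algebra_simps)
    next
      case False
      then have eN: "3 / 4 * e * real N \<le> 3 / 4 * e * real x" using e by (intro mult_left_mono) auto
      have p0: "0 \<le> 2 * real q * p" by (simp add: p_def)
      have "count_upto X x \<le> 2 * q" using count_upto_le_card[OF finX, of x] cX by linarith
      then have "real (count_upto Q x) \<le> e / 4 * real x + 3 / 4 * e * real x"
        using 1 P tx Np eN p0 by linarith
      moreover have "real (count_upto (P + X) x) \<le> 2 * real q * p"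
      proof -
        have "count_upto (P + X) x \<le> card P * (2 * q)"
          using count_upto_le_card[of "P + X" x] cPX P finX by (simp add: finite_set_plus)
        then have "real (count_upto (P + X) x) \<le> real (card P * (2 * q))" by (rule of_nat_mono)
        then show ?thesis by (simp add: p_def mult_ac)
      qed
      moreover have "real (count_upto (X + X) x) \<le> \<beta> * real x + 1 + 2 * real q"
      proof -
        have "count_upto (X + X) x \<le> count_upto I x + count_upto ((\<lambda>j. 2 * N + j * q) ` {..<2 * q}) x"
          using count_upto_mono[OF XX, of x] count_upto_Un[of I _ x] by (meson order_trans)
        also have "count_upto ((\<lambda>j. 2 * N + j * q) ` {..<2 * q}) x \<le> card ((\<lambda>j. 2 * N + j * q) ` {..<2 * q})"
          by (intro count_upto_le_card) simp
        also have "\<dots> \<le> 2 * q" using card_image_le[of "{..<2 * q}" "\<lambda>j. 2 * N + j * q"] by simp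
        finally have "count_upto (X + X) x \<le> count_upto I x + 2 * q" by simp
        then show ?thesis using cI[of x] by linarith
      qed
      moreover have "2 * real q + 1 \<le> 3 * real q" using q(1) by linarith
      ultimately have "real (count_upto (Q + Q) x) \<le> \<beta> * real x + e / 4 * real x + 3 / 4 * e * real x"
        using 2 P tx Np eN by linarith
      with \<open>real (count_upto Q x) \<le> e / 4 * real x + 3 / 4 * e * real x\<close> show ?thesis
        using ex by (simp add: algebra_simps)
    qed
  qed
  define y where "y = 2 * N + q * q"
  have "I \<subseteq> (Q + Q) \<inter> {1..y}"
  proof
    fix n assume n: "n \<in> I"
    then obtain a b where "a \<in> X" "b \<in> X" "n = a + b" using IXX by (blast elim: set_plus_elim)
    then have "a \<in> Q" "b \<in> Q" "n = a + b" by (auto simp: Q_def)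
    then have "n \<in> Q + Q" by (auto intro: set_plus_intro)
    then show "n \<in> (Q + Q) \<inter> {1..y}" using n Nt by (auto simp: I_def y_def)
  qed
  then have "card I \<le> count_upto (Q + Q) y" by (intro card_mono) auto
  then have "real (q * q) \<le> real (count_upto (Q + Q) y)" unfolding I_def by (simp flip: of_nat_mult)
  moreover have "(\<beta> - e) * real y \<le> s"
  proof (cases "\<beta> \<le> e")
    case True
    then have "(\<beta> - e) * real y \<le> 0" by (intro mult_nonpos_nonneg) auto
    moreover have "0 \<le> s" by (simp add: s_def)
    ultimately show ?thesis by linarith
  next
    case False
    have eq: "\<beta> * (2 * \<gamma> * s + s + 2) = s + 2 * \<beta> * \<delta> * s + 2 * \<beta>"
    proof -
      have "\<beta> * (2 * \<gamma> * s + s + 2) = (2 * \<beta> * \<gamma>) * s + \<beta> * s + 2 * \<beta>" by (simp add: algebra_simps)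
      then show ?thesis unfolding \<beta>\<gamma> by (simp add: algebra_simps)
    qed
    have yle: "real y \<le> 2 * \<gamma> * s + s + 2" using N(2) by (simp add: y_def s_def)
    have ys: "s \<le> real y" by (simp add: y_def s_def)
    have "\<beta> * real y \<le> s + 2 * \<beta> * \<delta> * s + 2 * \<beta>"
      using mult_left_mono[OF yle, of \<beta>] \<beta> eq by simp
    also have "\<dots> \<le> s + 2 * \<delta> * s + 2"
    proof -
      have "\<beta> * (2 * \<delta> * s) \<le> 1 * (2 * \<delta> * s)" using \<beta> \<delta> by (intro mult_right_mono) (auto simp: s_def)
      then show ?thesis using \<beta> by (simp add: mult_ac)
    qed
    also have "\<dots> \<le> s + e * s"
    proof -
      have "e * real q \<le> e * s" using qs e by simp
      then show ?thesis using q(4) by (simp add: \<delta>_def)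
    qed
    also have "\<dots> \<le> s + e * real y" using ys e by simp
    finally show ?thesis by (simp add: algebra_simps)
  qed
  ultimately have "(\<beta> - e) * real y \<le> real (count_upto (Q + Q) y)" by (simp add: s_def)
  moreover have "t < y" using Nt by (simp add: y_def)
  moreover have "Q \<inter> {..t} = P" using P XN Nt by (force simp: Q_def)
  ultimately show ?thesis using fin bound by blast
qed

text \<open>Stages alternate: even ones attain \<alpha> for the set, odd ones attain \<beta> for the
  sumset, and both kinds respect both upper bounds up to \<open>\<epsilon> n\<close>.\<close>

lemma exists_upper_densities:
  assumes \<alpha>: "0 \<le> \<alpha>" "\<alpha> \<le> 1" and \<beta>: "0 < \<beta>" "\<beta> \<le> 1" and f: "density_f \<alpha> \<le> \<beta>"
  shows "\<exists>A. upper_density A = \<alpha> \<and> upper_density (A + A) = \<beta>"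
proof -
  define \<epsilon> where "\<epsilon> n = 1 / (real n + 1)" for n :: nat
  have \<epsilon>: "0 < \<epsilon> n" for n by (simp add: \<epsilon>_def)
  \<comment> \<open>A state is a finite set with a cutoff so large that the set and its sumset are
    negligible there; for the start \<open>({}, 0)\<close> this is trivial.\<close>
  define Inv where "Inv n s \<longleftrightarrow> finite (fst s) \<and> fst s \<subseteq> {..snd s} \<and>
    real (card (fst s)) \<le> \<epsilon> n / 4 * real (snd s) \<and>
    real (card (fst s + fst s)) \<le> \<epsilon> n / 4 * real (snd s)" for n and s :: "nat set \<times> nat"
  define Step where "Step n s s' \<longleftrightarrow> snd s < snd s' \<and> fst s' \<inter> {..snd s} = fst s \<and>
    (\<forall>x>snd s. real (count_upto (fst s') x) \<le> (\<alpha> + \<epsilon> n) * real x \<and>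
       real (count_upto (fst s' + fst s') x) \<le> (\<beta> + \<epsilon> n) * real x) \<and>
    (if even n then \<exists>x>snd s. x \<le> snd s' \<and> (\<alpha> - \<epsilon> n) * real x \<le> real (count_upto (fst s') x)
     else \<exists>x>snd s. x \<le> snd s' \<and> (\<beta> - \<epsilon> n) * real x \<le> real (count_upto (fst s' + fst s') x))"
    for n and s s' :: "nat set \<times> nat"
  have "\<exists>s. \<forall>n. Inv n (s n) \<and> Step n (s n) (s (Suc n))"
  proof (rule dependent_nat_choice)
    show "\<exists>s. Inv 0 s" by (rule exI[of _ "({}, 0)"]) (simp add: Inv_def)
  next
    fix s n assume inv: "Inv n s"
    obtain P t where s: "s = (P, t)" by (cases s)
    have P: "finite P" "P \<subseteq> {..t}" "real (card P) \<le> \<epsilon> n / 4 * real t" "real (card (P + P)) \<le> \<epsilon> n / 4 * real t"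
      using inv by (auto simp: Inv_def s)
    have "\<exists>Q x. finite Q \<and> Q \<inter> {..t} = P \<and>
      (\<forall>x>t. real (count_upto Q x) \<le> (\<alpha> + \<epsilon> n) * real x \<and> real (count_upto (Q + Q) x) \<le> (\<beta> + \<epsilon> n) * real x) \<and>
      x > t \<and> (if even n then (\<alpha> - \<epsilon> n) * real x \<le> real (count_upto Q x)
       else (\<beta> - \<epsilon> n) * real x \<le> real (count_upto (Q + Q) x))"
      using interval_step[OF \<alpha> f \<epsilon> P] thin_step[OF \<beta> \<alpha>(1) \<epsilon> P] by (cases "even n") auto
    then obtain Q x where Q: "finite Q" "Q \<inter> {..t} = P"
      "\<forall>x>t. real (count_upto Q x) \<le> (\<alpha> + \<epsilon> n) * real x \<and> real (count_upto (Q + Q) x) \<le> (\<beta> + \<epsilon> n) * real x"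
      "x > t" "if even n then (\<alpha> - \<epsilon> n) * real x \<le> real (count_upto Q x)
       else (\<beta> - \<epsilon> n) * real x \<le> real (count_upto (Q + Q) x)" by blast
    \<comment> \<open>The next cutoff lies past the witness \<open>x\<close>, so that later stages
      preserve its count, and is large enough to restore the invariant.\<close>
    have "\<forall>\<^sub>F t' in sequentially. x \<le> t' \<and> Max (insert 0 Q) \<le> t' \<and>
      real (card Q) \<le> \<epsilon> (Suc n) / 4 * real t' \<and> real (card (Q + Q)) \<le> \<epsilon> (Suc n) / 4 * real t'"
      using \<epsilon>[of "Suc n"] by (intro eventually_conj eventually_ge_at_top eventually_le_mult_real) auto
    then obtain t' where t': "x \<le> t'" "Max (insert 0 Q) \<le> t'"
      "real (card Q) \<le> \<epsilon> (Suc n) / 4 * real t'" "real (card (Q + Q)) \<le> \<epsilon> (Suc n) / 4 * real t'"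
      by (auto simp: eventually_sequentially)
    have "Inv (Suc n) (Q, t')" using Q t' by (auto simp: Inv_def)
    moreover have "Step n s (Q, t')" using Q t' by (auto simp: Step_def s)
    ultimately show "\<exists>s'. Inv (Suc n) s' \<and> Step n s s'" by blast
  qed
  then obtain s where inv: "\<And>n. Inv n (s n)" and step: "\<And>n. Step n (s n) (s (Suc n))" by blast
  define P where "P n = fst (s n)" for n
  define t where "t n = snd (s n)" for n
  define A where "A = (\<Union>n. P n)"
  have "t n < t (Suc n)" for n using step[of n] by (simp add: Step_def t_def)
  then have mono: "strict_mono t" by (simp add: strict_mono_Suc_iff)
  have sub: "P n \<subseteq> {..t n}" for n using inv[of n] by (simp add: Inv_def P_def t_def)
  have ext: "P (Suc n) \<inter> {..t n} = P n" for n using step[of n] by (simp add: Step_def P_def t_def)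
  have A: "A \<inter> {..t n} = P n" for n unfolding A_def using mono sub ext by (rule chain_Int_atMost)
  have c1: "count_upto A x = count_upto (P n) x" if "x \<le> t n" for x n
  proof -
    have "A \<inter> {1..x} = (A \<inter> {..t n}) \<inter> {1..x}" using that by auto
    then show ?thesis by (simp only: A)
  qed
  have c2: "count_upto (A + A) x = count_upto (P n + P n) x" if "x \<le> t n" for x n
    using sumset_Int_eq[OF A that] by simp
  have small: "\<forall>\<^sub>F n in sequentially. \<epsilon> n \<le> e" if "0 < e" for e
    using eventually_le_mult_real[OF that, of 1]
  proof eventually_elim
    case (elim n)
    then have "1 \<le> e * (real n + 1)" using that by (simp add: algebra_simps)
    then show ?case by (simp add: \<epsilon>_def divide_le_eq)
  qed
  have up: "\<forall>\<^sub>F x in sequentially. real (count_upto A x) \<le> (\<alpha> + e) * real x \<and> real (count_upto (A + A) x) \<le> (\<beta> + e) * real x"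
    if "0 < e" for e
  proof (rule eventually_chain[OF mono], rule eventually_mono[OF small[OF that]], intro allI impI)
    fix n x assume n: "\<epsilon> n \<le> e" "t n < x" "x \<le> t (Suc n)"
    have "real (count_upto A x) \<le> (\<alpha> + \<epsilon> n) * real x \<and> real (count_upto (A + A) x) \<le> (\<beta> + \<epsilon> n) * real x"
      using step[of n] n unfolding c1[OF n(3)] c2[OF n(3)] by (simp add: Step_def t_def P_def)
    moreover have "(\<alpha> + \<epsilon> n) * real x \<le> (\<alpha> + e) * real x" "(\<beta> + \<epsilon> n) * real x \<le> (\<beta> + e) * real x"
      using n by (auto intro!: mult_right_mono)
    ultimately show "real (count_upto A x) \<le> (\<alpha> + e) * real x \<and> real (count_upto (A + A) x) \<le> (\<beta> + e) * real x"
      by linarith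
  qed
  have lo1: "\<exists>\<^sub>F x in sequentially. (\<alpha> - e) * real x \<le> real (count_upto A x)" if e: "0 < e" for e
  proof (rule frequently_chain[OF mono], unfold frequently_sequentially, intro allI)
    fix N
    obtain m where m: "\<And>n. m \<le> n \<Longrightarrow> \<epsilon> n \<le> e" using small[OF e] by (auto simp: eventually_sequentially)
    define n where "n = 2 * max N m"
    have "\<epsilon> n \<le> e" "even n" "N \<le> n" using m[of n] by (auto simp: n_def)
    then obtain x where x: "t n < x" "x \<le> t (Suc n)" "(\<alpha> - \<epsilon> n) * real x \<le> real (count_upto (P (Suc n)) x)"
      using step[of n] by (auto simp: Step_def t_def P_def)
    have "(\<alpha> - e) * real x \<le> (\<alpha> - \<epsilon> n) * real x" using \<open>\<epsilon> n \<le> e\<close> by (intro mult_right_mono) auto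
    then have "(\<alpha> - e) * real x \<le> real (count_upto A x)" using x c1[OF x(2)] by linarith
    then show "\<exists>n\<ge>N. \<exists>x\<ge>t n. (\<alpha> - e) * real x \<le> real (count_upto A x)"
      using x(1) \<open>N \<le> n\<close> by (meson less_imp_le)
  qed
  have lo2: "\<exists>\<^sub>F x in sequentially. (\<beta> - e) * real x \<le> real (count_upto (A + A) x)" if e: "0 < e" for e
  proof (rule frequently_chain[OF mono], unfold frequently_sequentially, intro allI)
    fix N
    obtain m where m: "\<And>n. m \<le> n \<Longrightarrow> \<epsilon> n \<le> e" using small[OF e] by (auto simp: eventually_sequentially)
    define n where "n = 2 * max N m + 1"
    have "\<epsilon> n \<le> e" "odd n" "N \<le> n" using m[of n] by (auto simp: n_def)
    then obtain x where x: "t n < x" "x \<le> t (Suc n)" "(\<beta> - \<epsilon> n) * real x \<le> real (count_upto (P (Suc n) + P (Suc n)) x)"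
      using step[of n] by (auto simp: Step_def t_def P_def)
    have "(\<beta> - e) * real x \<le> (\<beta> - \<epsilon> n) * real x" using \<open>\<epsilon> n \<le> e\<close> by (intro mult_right_mono) auto
    then have "(\<beta> - e) * real x \<le> real (count_upto (A + A) x)" using x c2[OF x(2)] by linarith
    then show "\<exists>n\<ge>N. \<exists>x\<ge>t n. (\<beta> - e) * real x \<le> real (count_upto (A + A) x)"
      using x(1) \<open>N \<le> n\<close> by (meson less_imp_le)
  qed
  have "upper_density A = \<alpha>"
    by (intro antisym upper_density_leI upper_density_geI lo1 eventually_mono[OF up]) auto
  moreover have "upper_density (A + A) = \<beta>"
    by (intro antisym upper_density_leI upper_density_geI lo2 eventually_mono[OF up]) auto
  ultimately show ?thesis by blast
qed

section \<open>Prescribed lower density of the sumset\<close>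

text \<open>Stage of the construction for the lower density: up to \<open>w\<close> nearly everything is in
  \<open>P + P\<close> although \<open>P\<close> is sparse, and \<open>P\<close> contains a long run after \<open>u\<close>, which added to
  an arithmetic progression of difference \<open>q\<close> will cover the next stage.\<close>

definition fill_state :: "real \<Rightarrow> nat set \<Rightarrow> nat \<Rightarrow> nat \<Rightarrow> nat \<Rightarrow> bool" where
  "fill_state e P w u q \<longleftrightarrow> finite P \<and> P \<subseteq> {..w} \<and> {u<..u + q} \<subseteq> P \<and> 8 \<le> e * real q \<and>
     1 \<le> e * real w \<and> real u \<le> e * real w \<and> real (card P) \<le> e * real w \<and>
     (1 - e) * real w \<le> real (count_upto (P + P) w) \<and> real (card (P + P)) \<le> (1 + e) * real w"

text \<open>Between \<open>w\<close> and \<open>N\<close> nothing is added, so the ratio of the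
  sumset sinks to \<beta>. From \<open>N\<close> on the progression \<open>X\<close> and the old run
  fill the sumset up to \<open>w'\<close>. The block \<open>R\<close> lifts the ratio of the set
  itself to \<alpha>.\<close>

lemma fill_step:
  assumes \<alpha>: "0 < \<alpha>" "\<alpha> \<le> 1" and \<beta>: "0 < \<beta>" "\<beta> \<le> 1" and e: "0 < e" "0 < e'" "e \<le> 2 * e'"
    and st: "fill_state e P w u q"
  shows "\<exists>Q w' u' q'. fill_state e' Q w' u' q' \<and> w < w' \<and> Q \<inter> {..w} = P \<and>
    (\<forall>x. w < x \<longrightarrow> x \<le> w' \<longrightarrow> real (count_upto Q x) \<le> (\<alpha> + 3 * e) * real x \<and>
       (\<beta> - 3 * e) * real x \<le> real (count_upto (Q + Q) x)) \<and>
    (\<exists>x\<ge>w. x \<le> w' \<and> (\<alpha> - e) * real x \<le> real (count_upto Q x)) \<and>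
    (\<exists>x\<ge>w. x \<le> w' \<and> real (count_upto (Q + Q) x) \<le> (\<beta> + 2 * e) * real x)"
proof -
  have P: "finite P" "P \<subseteq> {..w}" "{u<..u + q} \<subseteq> P" "8 \<le> e * real q" "1 \<le> e * real w"
    "real u \<le> e * real w" "real (card P) \<le> e * real w"
    "(1 - e) * real w \<le> real (count_upto (P + P) w)" "real (card (P + P)) \<le> (1 + e) * real w"
    using st unfolding fill_state_def by blast+
  have q: "0 < q" using P(4) by (auto intro: gr0I)
  \<comment> \<open>Just above w / \<beta>, so that about \<open>w\<close> sums below
    \<open>N\<close> have ratio \<beta> at \<open>N - 1\<close>.\<close>
  define N where "N = Suc (nat \<lfloor>real w / \<beta>\<rfloor>)"
  have w\<beta>: "0 \<le> real w / \<beta>" using \<beta> by simp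
  have "real w / \<beta> \<le> real N" unfolding N_def using w\<beta> by linarith
  then have N1: "real w \<le> \<beta> * real N" using \<beta> by (simp add: field_simps)
  have "real N - 1 \<le> real w / \<beta>" unfolding N_def using w\<beta> by linarith
  then have N2: "\<beta> * (real N - 1) \<le> real w" using \<beta> by (simp add: field_simps)
  have "real w \<le> real w / \<beta>" using \<beta> by (simp add: le_divide_eq mult_left_le)
  then have Nw: "w < N" unfolding N_def using w\<beta> by (simp add: le_nat_floor less_Suc_eq_le)
  have "\<forall>\<^sub>F M in sequentially. N < M \<and> real N + 1 \<le> e * real M \<and> 8 / e' + real N + 1 \<le> \<alpha> * real M"
    using e \<alpha> by (intro eventually_conj eventually_gt_at_top eventually_le_mult_real) auto
  then obtain M where M: "N < M" "real N + 1 \<le> e * real M" "8 / e' + real N + 1 \<le> \<alpha> * real M"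
    by (auto simp: eventually_sequentially)
  define K where "K = nat \<lfloor>\<alpha> * real M\<rfloor>"
  note K = floor_mult_bounds[OF less_imp_le[OF \<alpha>(1)] \<alpha>(2), of M, folded K_def]
  have "0 < 8 / e'" using e by simp
  then have NK: "8 / e' \<le> real (K - N)" "N \<le> K" using K(2) M(3) by linarith+
  define u' where "u' = M - K + N"
  define q' where "q' = K - N"
  have u'q': "u' + q' = M" "u' \<le> M" "N \<le> u'" using NK K(3) by (auto simp: u'_def q'_def)
  \<comment> \<open>\<open>R\<close> serves twice: it makes the count at \<open>M\<close> about
    \<open>\<alpha> * M\<close>, and it is the run of length \<open>q'\<close> for the next
    stage.\<close>
  define R where "R = {u'<..M}"
  have "\<forall>\<^sub>F L in sequentially. M \<le> L \<and> real (card P) + 1 + real M \<le> 3 / 4 * e' * real L \<and>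
      real N + real u \<le> e' * real L \<and> real M + 2 \<le> e' / 2 * real L \<and> 1 \<le> e' * real L"
    using e by (intro eventually_conj eventually_ge_at_top eventually_le_mult_real) auto
  then obtain L where L: "M \<le> L" "real (card P) + 1 + real M \<le> 3 / 4 * e' * real L"
      "real N + real u \<le> e' * real L" "real M + 2 \<le> e' / 2 * real L" "1 \<le> e' * real L"
    by (auto simp: eventually_sequentially)
  define w' where "w' = N + L * q"
  have Lq: "L \<le> L * q" using q by simp
  have w'L: "L \<le> w'" "M \<le> w'" "w < w'" using Lq L(1) Nw unfolding w'_def by linarith+
  have e'L: "e' * real L \<le> e' * real w'" using e w'L by (intro mult_left_mono) auto
  \<comment> \<open>\<open>q\<close> was chosen for the tolerance \<open>e\<close>, but
    \<open>X\<close> must be sparse for the smaller \<open>e'\<close>; this is where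
    \<open>e \<le> 2 * e'\<close> enters.\<close>
  have L4: "4 * real L \<le> e' * real w'"
  proof -
    have "8 \<le> 2 * e' * real q" using P(4) mult_right_mono[OF e(3), of "real q"] by simp
    then have "4 * real L \<le> (e' * real q) * real L" by (intro mult_right_mono) auto
    also have "\<dots> = e' * real (L * q)" by simp
    also have "\<dots> \<le> e' * real w'" using e by (intro mult_left_mono) (auto simp: w'_def)
    finally show ?thesis .
  qed
  define X where "X = (\<lambda>j. N + j * q) ` {..L}"
  define Q where "Q = P \<union> X \<union> R"
  have finX: "finite X" by (simp add: X_def)
  have fin: "finite Q" using P finX by (simp add: Q_def R_def)
  have XN: "N \<le> a" if "a \<in> X \<union> R" for a using that u'q' by (auto simp: X_def R_def)
  have Pw: "a \<le> w" if "a \<in> P" for a using that P by auto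
  have Qw: "Q \<inter> {..w} = P"
  proof -
    have "a \<notin> X \<union> R" if "a \<le> w" for a using XN[of a] that Nw by auto
    then show ?thesis using Pw by (auto simp: Q_def)
  qed
  have Qw': "Q \<subseteq> {..w'}"
    using Pw w'L by (force simp: Q_def X_def R_def w'_def)
  have cX: "card X \<le> L + 1" unfolding X_def using card_image_le[of "{..L}"] by fastforce
  have cR: "count_upto R x \<le> count_upto {M - K<..M} x" for x
    by (rule count_upto_mono) (auto simp: R_def u'_def)
  \<comment> \<open>Division with remainder by \<open>q\<close>: the quotient picks the term of the
    progression, the remainder the element of the run. The uncovered piece up to
    \<open>N + u\<close> is short since \<open>u \<le> e * w\<close>.\<close>
  have fill: "{N + u<..w'} \<subseteq> Q + Q"
  proof
    fix n assume n: "n \<in> {N + u<..w'}"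
    define m where "m = n - (N + u + 1)"
    have m: "n = N + u + 1 + m" using n by (auto simp: m_def)
    have "m < L * q" using n m by (auto simp: w'_def)
    then have "m div q < L" by (rule less_mult_imp_div_less)
    then have "N + m div q * q \<in> Q" by (auto simp: Q_def X_def)
    moreover have "u + 1 + m mod q \<in> {u<..u + q}" using q by (simp add: Suc_le_eq)
    then have "u + 1 + m mod q \<in> Q" using P(3) unfolding Q_def by blast
    ultimately have "(N + m div q * q) + (u + 1 + m mod q) \<in> Q + Q" by (rule set_plus_intro)
    moreover have "(N + m div q * q) + (u + 1 + m mod q) = n"
      unfolding m using div_mult_mod_eq[of m q] by linarith
    ultimately show "n \<in> Q + Q" by simp
  qed
  have PQ: "P + P \<subseteq> Q + Q" unfolding Q_def by (intro set_plus_mono2) auto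
  have "fill_state e' Q w' u' q'"
    unfolding fill_state_def
  proof (intro conjI)
    show "{u'<..u' + q'} \<subseteq> Q" using u'q' by (simp add: Q_def R_def)
    show "8 \<le> e' * real q'" using NK(1)[folded q'_def] e by (simp add: field_simps)
    show "1 \<le> e' * real w'" using L(5) e'L by linarith
    show "real u' \<le> e' * real w'" using L(4,5) e'L u'q'(2) by (simp add: algebra_simps)
    have "card Q \<le> card P + card X + card R"
      unfolding Q_def by (meson add_mono card_Un_le order_refl order_trans)
    also have "card R \<le> M" by (simp add: R_def)
    finally have "real (card Q) \<le> real (card P) + (real L + 1) + real M" using cX by linarith
    then show "real (card Q) \<le> e' * real w'" using L(2) L4 e'L by (simp add: algebra_simps)
    have "card {N + u<..w'} \<le> count_upto (Q + Q) w'"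
      using fill by (intro card_mono) auto
    then have "real w' - (real N + real u) \<le> real (count_upto (Q + Q) w')" by simp
    then show "(1 - e') * real w' \<le> real (count_upto (Q + Q) w')"
      using L(3) e'L by (simp add: algebra_simps)
    \<comment> \<open>Only sums of two elements of \<open>X\<close> can exceed
      \<open>w' + M\<close>, and they lie in a progression of \<open>2 * L + 1\<close> terms; so the
      gap after \<open>w'\<close> stays nearly empty.\<close>
    have "Q + Q \<subseteq> {..w' + M} \<union> (\<lambda>j. 2 * N + j * q) ` {..2 * L}"
    proof
      fix n assume "n \<in> Q + Q"
      then obtain a b where ab: "a \<in> Q" "b \<in> Q" "n = a + b" by (blast elim: set_plus_elim)
      have le: "a \<le> w'" "b \<le> w'" using ab Qw' by auto
      have small: "c \<le> M" if "c \<in> Q" "c \<notin> X" for c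
        using that Pw[of c] Nw M(1) by (auto simp: Q_def R_def)
      show "n \<in> {..w' + M} \<union> (\<lambda>j. 2 * N + j * q) ` {..2 * L}"
      proof (cases "a \<in> X \<and> b \<in> X")
        case True
        then obtain i j where "i \<le> L" "j \<le> L" "a = N + i * q" "b = N + j * q" by (auto simp: X_def)
        then have "n = 2 * N + (i + j) * q" "i + j \<le> 2 * L" using ab by (auto simp: algebra_simps)
        then show ?thesis by blast
      next
        case False
        then have "a \<le> M \<or> b \<le> M" using small ab by blast
        then show ?thesis using le ab by auto
      qed
    qed
    then have "card (Q + Q) \<le> card ({..w' + M} \<union> (\<lambda>j. 2 * N + j * q) ` {..2 * L})"
      by (intro card_mono) auto
    also have "\<dots> \<le> card {..w' + M} + card ((\<lambda>j. 2 * N + j * q) ` {..2 * L})" by (rule card_Un_le)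
    also have "card ((\<lambda>j. 2 * N + j * q) ` {..2 * L}) \<le> 2 * L + 1"
      using card_image_le[of "{..2 * L}" "\<lambda>j. 2 * N + j * q"] by simp
    finally have "real (card (Q + Q)) \<le> real w' + real M + 2 + 2 * real L" by simp
    then show "real (card (Q + Q)) \<le> (1 + e') * real w'" using L(4) L4 e'L by (simp add: algebra_simps)
  qed (use fin Qw' in auto)
  moreover have "real (count_upto Q x) \<le> (\<alpha> + 3 * e) * real x" if x: "w < x" for x
  proof -
    have wx: "e * real w \<le> e * real x" using x e by (intro mult_left_mono) auto
    have "X \<inter> {1..x} \<subseteq> (\<lambda>j. N + j * q) ` {..x div q}"
    proof
      fix a assume "a \<in> X \<inter> {1..x}"
      then obtain j where j: "a = N + j * q" "j * q \<le> x" by (auto simp: X_def)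
      then have "j \<le> x div q" using q by (simp add: less_eq_div_iff_mult_less_eq)
      then show "a \<in> (\<lambda>j. N + j * q) ` {..x div q}" using j by blast
    qed
    then have "count_upto X x \<le> card ((\<lambda>j. N + j * q) ` {..x div q})" by (intro card_mono) auto
    also have "\<dots> \<le> x div q + 1" using card_image_le[of "{..x div q}" "\<lambda>j. N + j * q"] by simp
    finally have cX: "count_upto X x \<le> x div q + 1" .
    have "8 * real (x div q) \<le> (e * real q) * real (x div q)" using P(4) by (intro mult_right_mono) auto
    also have "\<dots> = e * real (x div q * q)" by simp
    also have "\<dots> \<le> e * real x" using e by (intro mult_left_mono) (auto simp del: of_nat_mult)
    finally have d8: "8 * real (x div q) \<le> e * real x" .
    have "count_upto Q x \<le> count_upto P x + count_upto X x + count_upto R x"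
      unfolding Q_def by (meson add_mono count_upto_Un order_refl order_trans)
    also have "count_upto P x \<le> card P" using P by (intro count_upto_le_card)
    finally have "real (count_upto Q x) \<le> real (card P) + real (count_upto X x) + real (count_upto {M - K<..M} x)"
      using cR[of x] by linarith
    also have "\<dots> \<le> e * real w + (real (x div q) + 1) + \<alpha> * real x"
      using P(7) cX count_upto_interval_le[OF less_imp_le[OF \<alpha>(1)] \<alpha>(2) K(1,3), of x] by linarith
    also have "\<dots> \<le> \<alpha> * real x + 3 * (e * real x)" using wx d8 P(5) by linarith
    finally show ?thesis by (simp add: algebra_simps)
  qed
  moreover have "(\<beta> - 3 * e) * real x \<le> real (count_upto (Q + Q) x)" if x: "w < x" "x \<le> w'" for x
  proof -
    have wx: "e * real w \<le> e * real x" using x e by (intro mult_left_mono) auto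
    have PP: "real w - e * real w \<le> real (count_upto (P + P) w)" using P(8) by (simp add: algebra_simps)
    show ?thesis
    proof (cases "x < N")
      case True
      have "(P + P) \<inter> {1..w} \<subseteq> (Q + Q) \<inter> {1..x}" using PQ x by auto
      then have "count_upto (P + P) w \<le> count_upto (Q + Q) x" by (intro card_mono) auto
      moreover have "\<beta> * real x \<le> \<beta> * (real N - 1)" using True \<beta> by (intro mult_left_mono) auto
      moreover have "0 \<le> e * real x" using e by simp
      ultimately have "\<beta> * real x - 3 * (e * real x) \<le> real (count_upto (Q + Q) x)"
        using PP N2 wx by linarith
      then show ?thesis by (simp add: algebra_simps)
    next
      case False
      have "((P + P) \<inter> {1..w}) \<union> {N + u<..x} \<subseteq> (Q + Q) \<inter> {1..x}"
        using PQ x fill by auto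
      then have "card (((P + P) \<inter> {1..w}) \<union> {N + u<..x}) \<le> count_upto (Q + Q) x"
        by (intro card_mono) auto
      moreover have "card (((P + P) \<inter> {1..w}) \<union> {N + u<..x}) = count_upto (P + P) w + card {N + u<..x}"
        using Nw by (intro card_Un_disjoint) auto
      ultimately have "real (count_upto (P + P) w) + (real x - real N - real u) \<le> real (count_upto (Q + Q) x)"
        by simp
      moreover have "\<beta> * (real x - real N) \<le> real x - real N"
        using False \<beta> by (intro mult_left_le_one_le) auto
      moreover have "\<beta> * real x = \<beta> * (real N - 1) + \<beta> * (real x - real N) + \<beta>" by (simp add: algebra_simps)
      ultimately have "\<beta> * real x - 3 * (e * real x) \<le> real (count_upto (Q + Q) x)"
        using PP N2 wx P(5,6) \<beta>(2) by linarith
      then show ?thesis by (simp add: algebra_simps)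
    qed
  qed
  moreover have "(\<alpha> - e) * real M \<le> real (count_upto Q M)"
  proof -
    have "count_upto R M \<le> count_upto Q M" by (rule count_upto_mono) (simp add: Q_def)
    then have "M - u' \<le> count_upto Q M" unfolding R_def count_upto_greaterThanAtMost by simp
    then have "real K - real N \<le> real (count_upto Q M)" using NK K(3) unfolding u'_def by linarith
    then show ?thesis using K(2) M(2) by (simp add: algebra_simps)
  qed
  moreover have "real (count_upto (Q + Q) (N - 1)) \<le> (\<beta> + 2 * e) * real (N - 1)"
  proof -
    have "(Q + Q) \<inter> {1..N - 1} \<subseteq> P + P"
    proof
      fix n assume n: "n \<in> (Q + Q) \<inter> {1..N - 1}"
      then obtain a b where ab: "a \<in> Q" "b \<in> Q" "n = a + b" by (blast elim: set_plus_elim)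
      then have "a < N" "b < N" using n by auto
      then have "a \<in> P" "b \<in> P" using ab XN by (auto simp: Q_def dest: leD)
      then show "n \<in> P + P" using ab by (auto intro: set_plus_intro)
    qed
    then have "count_upto (Q + Q) (N - 1) \<le> card (P + P)"
      using P by (intro card_mono finite_set_plus)
    then have "real (count_upto (Q + Q) (N - 1)) \<le> real w + e * real w" using P(9) by (simp add: algebra_simps)
    also have "\<dots> \<le> \<beta> * real (N - 1) + \<beta> + e * real w" using N1 Nw by (simp add: of_nat_diff algebra_simps)
    also have "\<dots> \<le> \<beta> * real (N - 1) + 2 * (e * real (N - 1))"
    proof -
      have "e * real w \<le> e * real (N - 1)" using e Nw by (intro mult_left_mono) auto
      then show ?thesis using P(5) \<beta>(2) by linarith
    qed
    finally show ?thesis by (simp add: algebra_simps)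
  qed
  moreover have "w \<le> N - 1" "N - 1 \<le> w'" "w \<le> M" using Nw M(1) w'L by auto
  ultimately show ?thesis using Qw w'L by blast
qed

lemma exists_upper_lower_density:
  assumes \<alpha>: "0 \<le> \<alpha>" "\<alpha> \<le> 1" and \<beta>: "0 \<le> \<beta>" "\<beta> \<le> 1"
  shows "\<exists>A. upper_density A = \<alpha> \<and> lower_density (A + A) = \<beta>"
proof -
  define \<epsilon> where "\<epsilon> n = 1 / (real n + 1)" for n :: nat
  have \<epsilon>: "0 < \<epsilon> n" "\<epsilon> n \<le> 1" "\<epsilon> n \<le> 2 * \<epsilon> (Suc n)" for n by (auto simp: \<epsilon>_def field_simps)
  \<comment> \<open>\<open>fill_step\<close> divides by \<beta> and needs runs of length about
    \<alpha> * M, so both targets are raised to at least \<open>\<epsilon> n\<close>, which tends to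
    0.\<close>
  define \<alpha>' where "\<alpha>' n = max \<alpha> (\<epsilon> n)" for n
  define \<beta>' where "\<beta>' n = max \<beta> (\<epsilon> n)" for n
  have \<alpha>': "0 < \<alpha>' n" "\<alpha>' n \<le> 1" "\<alpha> \<le> \<alpha>' n" "\<alpha>' n \<le> \<alpha> + \<epsilon> n" for n
    using \<epsilon>[of n] \<alpha> by (auto simp: \<alpha>'_def)
  have \<beta>': "0 < \<beta>' n" "\<beta>' n \<le> 1" "\<beta> \<le> \<beta>' n" "\<beta>' n \<le> \<beta> + \<epsilon> n" for n
    using \<epsilon>[of n] \<beta> by (auto simp: \<beta>'_def)
  define Inv where "Inv n s \<longleftrightarrow> (case s of (P, w, u, q) \<Rightarrow> fill_state (\<epsilon> n) P w u q)"
    for n and s :: "nat set \<times> nat \<times> nat \<times> nat"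
  define Step where "Step n s s' \<longleftrightarrow> (case s of (P, w, u, q) \<Rightarrow> case s' of (Q, w', u', q') \<Rightarrow>
    w < w' \<and> Q \<inter> {..w} = P \<and>
    (\<forall>x. w < x \<longrightarrow> x \<le> w' \<longrightarrow> real (count_upto Q x) \<le> (\<alpha>' n + 3 * \<epsilon> n) * real x \<and>
       (\<beta>' n - 3 * \<epsilon> n) * real x \<le> real (count_upto (Q + Q) x)) \<and>
    (\<exists>x\<ge>w. x \<le> w' \<and> (\<alpha>' n - \<epsilon> n) * real x \<le> real (count_upto Q x)) \<and>
    (\<exists>x\<ge>w. x \<le> w' \<and> real (count_upto (Q + Q) x) \<le> (\<beta>' n + 2 * \<epsilon> n) * real x))"
    for n and s s' :: "nat set \<times> nat \<times> nat \<times> nat"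
  have "\<exists>s. \<forall>n. Inv n (s n) \<and> Step n (s n) (s (Suc n))"
  proof (rule dependent_nat_choice)
    \<comment> \<open>For tolerance 1 the shortest admissible run has 8 elements; with
      \<open>w = 8\<close> the remaining conditions are coarse enough to hold.\<close>
    have "fill_state 1 {1..8} 8 0 8"
    proof -
      have "{1..8} + {1..8} \<subseteq> {1..16::nat}" by (auto elim!: set_plus_elim)
      then have "card ({1..8} + {1..8} :: nat set) \<le> card {1..16::nat}" by (intro card_mono) auto
      then show ?thesis by (auto simp: fill_state_def)
    qed
    then show "\<exists>s. Inv 0 s" by (intro exI[of _ "({1..8}, 8, 0, 8)"]) (simp add: Inv_def \<epsilon>_def)
  next
    fix s n assume inv: "Inv n s"
    obtain P w u q where s: "s = (P, w, u, q)" by (cases s)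
    have "fill_state (\<epsilon> n) P w u q" using inv by (simp add: Inv_def s)
    from fill_step[OF \<alpha>'(1)[of n] \<alpha>'(2) \<beta>'(1)[of n] \<beta>'(2) \<epsilon>(1) \<epsilon>(1) \<epsilon>(3) this]
    obtain Q w' u' q' where "fill_state (\<epsilon> (Suc n)) Q w' u' q'" "Step n s (Q, w', u', q')"
      unfolding Step_def s prod.case by blast
    then show "\<exists>s'. Inv (Suc n) s' \<and> Step n s s'"
      by (intro exI[of _ "(Q, w', u', q')"]) (simp add: Inv_def)
  qed
  then obtain s where inv: "\<And>n. Inv n (s n)" and step: "\<And>n. Step n (s n) (s (Suc n))" by blast
  define P where "P n = fst (s n)" for n
  define t where "t n = fst (snd (s n))" for n
  define A where "A = (\<Union>n. P n)"
  have S: "t n < t (Suc n)" "P (Suc n) \<inter> {..t n} = P n"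
    "\<And>x. t n < x \<Longrightarrow> x \<le> t (Suc n) \<Longrightarrow> real (count_upto (P (Suc n)) x) \<le> (\<alpha>' n + 3 * \<epsilon> n) * real x \<and>
       (\<beta>' n - 3 * \<epsilon> n) * real x \<le> real (count_upto (P (Suc n) + P (Suc n)) x)"
    "\<exists>x\<ge>t n. x \<le> t (Suc n) \<and> (\<alpha>' n - \<epsilon> n) * real x \<le> real (count_upto (P (Suc n)) x)"
    "\<exists>x\<ge>t n. x \<le> t (Suc n) \<and> real (count_upto (P (Suc n) + P (Suc n)) x) \<le> (\<beta>' n + 2 * \<epsilon> n) * real x" for n
    using step[of n] unfolding Step_def P_def t_def by (simp_all add: split_beta)
  have mono: "strict_mono t" using S(1) by (simp add: strict_mono_Suc_iff)
  have sub: "P n \<subseteq> {..t n}" for n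
    using inv[of n] by (simp add: Inv_def fill_state_def P_def t_def split_beta)
  have A: "A \<inter> {..t n} = P n" for n unfolding A_def using mono sub S(2) by (rule chain_Int_atMost)
  have c1: "count_upto A x = count_upto (P n) x" if "x \<le> t n" for x n
  proof -
    have "A \<inter> {1..x} = (A \<inter> {..t n}) \<inter> {1..x}" using that by auto
    then show ?thesis by (simp only: A)
  qed
  have c2: "count_upto (A + A) x = count_upto (P n + P n) x" if "x \<le> t n" for x n
    using sumset_Int_eq[OF A that] by simp
  have small: "\<forall>\<^sub>F n in sequentially. 4 * \<epsilon> n \<le> e" if "0 < e" for e
    using eventually_le_mult_real[OF that, of 4]
  proof eventually_elim
    case (elim n)
    then have "4 \<le> e * (real n + 1)" using that by (simp add: algebra_simps)
    then show ?case by (simp add: \<epsilon>_def divide_le_eq)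
  qed
  have bounds: "\<forall>\<^sub>F x in sequentially. real (count_upto A x) \<le> (\<alpha> + e) * real x \<and> (\<beta> - e) * real x \<le> real (count_upto (A + A) x)"
    if "0 < e" for e
  proof (rule eventually_chain[OF mono], rule eventually_mono[OF small[OF that]], intro allI impI)
    fix n x assume n: "4 * \<epsilon> n \<le> e" "t n < x" "x \<le> t (Suc n)"
    have "(\<alpha>' n + 3 * \<epsilon> n) * real x \<le> (\<alpha> + e) * real x" "(\<beta> - e) * real x \<le> (\<beta>' n - 3 * \<epsilon> n) * real x"
      using n \<alpha>'[of n] \<beta>'[of n] \<epsilon>[of n] by (auto intro!: mult_right_mono)
    then show "real (count_upto A x) \<le> (\<alpha> + e) * real x \<and> (\<beta> - e) * real x \<le> real (count_upto (A + A) x)"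
      using S(3)[OF n(2,3)] unfolding c1[OF n(3)] c2[OF n(3)] by linarith
  qed
  have lo: "\<exists>\<^sub>F x in sequentially. (\<alpha> - e) * real x \<le> real (count_upto A x)" if e: "0 < e" for e
  proof (rule frequently_chain[OF mono], rule eventually_frequently, simp, rule eventually_mono[OF small[OF e]])
    fix n assume n: "4 * \<epsilon> n \<le> e"
    obtain x where x: "t n \<le> x" "x \<le> t (Suc n)" "(\<alpha>' n - \<epsilon> n) * real x \<le> real (count_upto (P (Suc n)) x)"
      using S(4)[of n] by blast
    have "(\<alpha> - e) * real x \<le> (\<alpha>' n - \<epsilon> n) * real x"
      using n \<alpha>'[of n] \<epsilon>[of n] by (intro mult_right_mono) auto
    then have "(\<alpha> - e) * real x \<le> real (count_upto A x)" using x c1[OF x(2)] by linarith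
    then show "\<exists>x\<ge>t n. (\<alpha> - e) * real x \<le> real (count_upto A x)" using x(1) by blast
  qed
  have hi: "\<exists>\<^sub>F x in sequentially. real (count_upto (A + A) x) \<le> (\<beta> + e) * real x" if e: "0 < e" for e
  proof (rule frequently_chain[OF mono], rule eventually_frequently, simp, rule eventually_mono[OF small[OF e]])
    fix n assume n: "4 * \<epsilon> n \<le> e"
    obtain x where x: "t n \<le> x" "x \<le> t (Suc n)"
      "real (count_upto (P (Suc n) + P (Suc n)) x) \<le> (\<beta>' n + 2 * \<epsilon> n) * real x"
      using S(5)[of n] by blast
    have "(\<beta>' n + 2 * \<epsilon> n) * real x \<le> (\<beta> + e) * real x"
      using n \<beta>'[of n] \<epsilon>[of n] by (intro mult_right_mono) auto
    then have "real (count_upto (A + A) x) \<le> (\<beta> + e) * real x" using x c2[OF x(2)] by linarith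
    then show "\<exists>x\<ge>t n. real (count_upto (A + A) x) \<le> (\<beta> + e) * real x" using x(1) by blast
  qed
  have "upper_density A = \<alpha>"
    by (intro antisym upper_density_leI upper_density_geI lo eventually_mono[OF bounds]) auto
  moreover have "lower_density (A + A) = \<beta>"
    by (intro antisym lower_density_leI lower_density_geI hi eventually_mono[OF bounds]) auto
  ultimately show ?thesis by blast
qed

lemma exists_scaled_upper_densities:
  assumes U: "(\<alpha>1, \<alpha>2) \<in> region_U" and k: "1 \<le> k"
  shows "\<exists>A. upper_density A = 1 / real k * \<alpha>1 \<and> upper_density (A + A) = 1 / real k * \<alpha>2"
proof (cases "\<alpha>2 = 0")
  \<comment> \<open>Here \<open>density_f\<close> forces \<alpha>1 = 0 too, and the empty set
    serves; the staged construction needs a positive density of the sumset.\<close>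
  case True
  then have "\<alpha>1 = 0" using U by (auto simp: region_U_def density_f_def min_def split: if_splits)
  have "upper_density {} = 0" by (simp add: upper_density_finite)
  then show ?thesis using True \<open>\<alpha>1 = 0\<close> by (intro exI[of _ "{}"]) (simp add: set_plus_def)
next
  case False
  then obtain B where B: "upper_density B = \<alpha>1" "upper_density (B + B) = \<alpha>2"
    using exists_upper_densities[of \<alpha>1 \<alpha>2] U by (auto simp: region_U_def)
  \<comment> \<open>The summand 0 gives the map the shape of
    \<open>sumset_affine_image\<close>.\<close>
  define A where "A = (\<lambda>b. 0 + k * b) ` B"
  have "upper_density A = \<alpha>1 / real k" "upper_density (A + A) = \<alpha>2 / real k"
    unfolding A_def sumset_affine_image using k B by (subst upper_density_affine_image; simp)+
  then show ?thesis by auto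
qed

theorem theorem1p2:
  shows "{(upper_density A, upper_density (A + A)) | A :: nat set. True} =
           {(1 / real k * \<alpha>1, 1 / real k * \<alpha>2) | \<alpha>1 \<alpha>2 k. (\<alpha>1, \<alpha>2) \<in> region_U \<and> k \<ge> 1} \<and>
         {(upper_density A, lower_density (A + A)) | A :: nat set. True} =
           {0..1} \<times> {0..1}"
proof (intro conjI equalityI subsetI)
  fix p assume "p \<in> {(upper_density A, upper_density (A + A)) | A :: nat set. True}"
  then show "p \<in> {(1 / real k * \<alpha>1, 1 / real k * \<alpha>2) | \<alpha>1 \<alpha>2 k. (\<alpha>1, \<alpha>2) \<in> region_U \<and> k \<ge> 1}"
    using upper_densities_sumset_mem by blast
next
  fix p assume "p \<in> {(1 / real k * \<alpha>1, 1 / real k * \<alpha>2) | \<alpha>1 \<alpha>2 k. (\<alpha>1, \<alpha>2) \<in> region_U \<and> k \<ge> 1}"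
  then obtain \<alpha>1 \<alpha>2 k where p: "p = (1 / real k * \<alpha>1, 1 / real k * \<alpha>2)" "(\<alpha>1, \<alpha>2) \<in> region_U" "1 \<le> k"
    by blast
  obtain A where "upper_density A = 1 / real k * \<alpha>1" "upper_density (A + A) = 1 / real k * \<alpha>2"
    using exists_scaled_upper_densities[OF p(2,3)] by blast
  then show "p \<in> {(upper_density A, upper_density (A + A)) | A :: nat set. True}"
    unfolding p(1) by (metis (mono_tags, lifting) mem_Collect_eq)
next
  fix p assume "p \<in> {(upper_density A, lower_density (A + A)) | A :: nat set. True}"
  then show "p \<in> {0..1} \<times> {0..1}"
    using upper_density_nonneg upper_density_le_1 lower_density_bounds by auto
next
  fix p :: "real \<times> real" assume "p \<in> {0..1} \<times> {0..1}"
  then obtain \<alpha> \<beta> where p: "p = (\<alpha>, \<beta>)" "0 \<le> \<alpha>" "\<alpha> \<le> 1" "0 \<le> \<beta>" "\<beta> \<le> 1" by auto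
  obtain A where "upper_density A = \<alpha>" "lower_density (A + A) = \<beta>"
    using exists_upper_lower_density[OF p(2-5)] by blast
  then show "p \<in> {(upper_density A, lower_density (A + A)) | A :: nat set. True}"
    unfolding p(1) by blast
qed

end
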